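(* Consider Model 1 (described in the context) with decision functions satisfying the NS assumptions, and suppose that (A1) is satisfied. Fix $t\in(0,1)$, and let $\mathbf p=(p_m)_{m\in\mathcal M}$ and $\boldsymbol\gamma=(\gamma_m)_{m\in\mathcal M}$ be given. Then the maximum of $$\pi(\mathbf t,\mathbf p,\boldsymbol\gamma)=E\Big[\sum_{m\in\mathcal M}\theta_m\delta_m(Z_m;t_m)\,\Big|\,\mathbf p,\boldsymbol\gamma\Big]=\sum_{m\in\mathcal M}p_m\pi_{\gamma_m}(t_m)$$ with respect to the threshold vector $\mathbf t=(t_m)_{m\in\mathcal M}$, subject to the constraint $\bar t=M^{-1}\sum_{m\in\mathcal M}t_m=t$, exists, is unique, and satisfies $$\pi_{\gamma_m}'(t_m)=k/p_m$$ for every $m\in\mathcal M$ and some $k>0$.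
   Context: $\mathcal M=\{1,\dots,M\}$. Model 1: $(Z_m,\theta_m,p_m,\gamma_m)$, $m\in\mathcal M$, are i.i.d. random vectors with support in $\mathbb R\times\{0,1\}\times[0,1]\times\mathbb R^+$ and conditional distribution functions $F(z_m|\theta_m,p_m,\gamma_m)=(1-\theta_m)F_0(z_m)+\theta_mF_1(z_m|\gamma_m)$ and $F(z_m|p_m,\gamma_m)=(1-p_m)F_0(z_m)+p_mF_1(z_m|\gamma_m)$; moreover $F(\gamma_m,p_m)=F(\gamma_m)F(p_m)$ (i.e. $p_m$ and $\gamma_m$ are independent), $\mathrm{Var}(\gamma_m)<\infty$, and $p_m$ has mean $1-a_0\in(0,1)$. Decision functions: $\delta_m(Z_m;t_m)\in\{0,1\}$ (1 means that the null hypothesis $H_m:\theta_m=0$ is rejected), with size threshold $t_m\in[0,1]$. NS assumptions: for each $m$, $t_m\mapsto\delta_m(Z_m;t_m)$ is nondecreasing and right continuous with $\delta_m=0$ at $t_m=0$ and $\delta_m=1$ at $t_m=1$, almost surely; $t_m\mapsto E[\delta_m(Z_m;t_m)]$ is continuous and strictly increasing for $t_m\in(0,1)$; and $E[\delta_m(Z_m;t_m)]=t_m$ when $\theta_m=0$. Power function: $\pi_{\gamma_m}(t_m)=E[\delta_m(Z_m;t_m)\,|\,\theta_m=1,\gamma_m]$, and $\pi_{\gamma_m}'$ denotes its derivative with respect to $t_m$. (A1): for each $m\in\mathcal M$, $t_m\mapsto\pi_{\gamma_m}(t_m)$ is concave and twice differentiable for $t_m\in(0,1)$, with $\lim_{t_m\uparrow1}\pi_{\gamma_m}'(t_m)=0$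 and $\lim_{t_m\downarrow0}\pi_{\gamma_m}'(t_m)=\infty$ almost surely.
   Formalization: Concavity in (A1) is taken to be strict and to hold on all of [0,1], and the maximum claim is proved for realisations with every p_m>0; affine pieces, a jump of the power at t_m=1, or p_m=0 can break uniqueness, interiority or the formula k/p_m. *)

theory Defs
  imports "HOL-Probability.Probability"
begin

definition sigma_gen :: "'w measure \<Rightarrow> 'x measure \<Rightarrow> ('w \<Rightarrow> 'x) \<Rightarrow> 'w measure" where
  "sigma_gen \<Omega> N X = vimage_algebra (space \<Omega>) X N"

text \<open>
  The model is a conditional mixture: \<open>F0\<close> is the null distribution and the probability kernel
  \<open>F1\<close> sends an effect \<open>g\<close> to the conditional distribution of an observation given
  \<open>\<theta> = 1\<close> and \<open>\<gamma> = g\<close>.  The conditional distribution functions are versions of the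
  conditional probabilities of the events \<open>Z m \<le> z\<close>.
\<close>

locale model1 = prob_space \<Omega> for \<Omega> :: "'w measure" +
  fixes M :: nat
    and Z \<theta> p \<gamma> :: "nat \<Rightarrow> 'w \<Rightarrow> real"
    and F0 :: "real measure" and F1 :: "real \<Rightarrow> real measure"
    and a0 :: real
  assumes M_pos: "1 \<le> M"
    and F0_distribution: "F0 \<in> space (prob_algebra borel)"
    and F1_kernel: "F1 \<in> measurable (restrict_space borel {0..}) (prob_algebra borel)"
    and independent:
      "indep_vars (\<lambda>_. borel) (\<lambda>m \<omega>. (Z m \<omega>, \<theta> m \<omega>, p m \<omega>, \<gamma> m \<omega>)) {1..M}"
    and identically_distributed:
      "\<And>i j. i \<in> {1..M} \<Longrightarrow> j \<in> {1..M} \<Longrightarrow>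
         distr \<Omega> borel (\<lambda>\<omega>. (Z i \<omega>, \<theta> i \<omega>, p i \<omega>, \<gamma> i \<omega>))
       = distr \<Omega> borel (\<lambda>\<omega>. (Z j \<omega>, \<theta> j \<omega>, p j \<omega>, \<gamma> j \<omega>))"
    and support:
      "\<And>m. m \<in> {1..M} \<Longrightarrow>
         AE \<omega> in \<Omega>. \<theta> m \<omega> \<in> {0, 1} \<and> p m \<omega> \<in> {0..1} \<and> \<gamma> m \<omega> \<in> {0..}"
    and cond_distribution_theta_p_gamma:
      "\<And>m z. m \<in> {1..M} \<Longrightarrow>
         AE \<omega> in \<Omega>.
           real_cond_exp \<Omega> (sigma_gen \<Omega> borel (\<lambda>\<omega>. (\<theta> m \<omega>, p m \<omega>, \<gamma> m \<omega>)))
             (indicator {\<omega> \<in> space \<Omega>. Z m \<omega> \<le> z}) \<omega>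
           = (1 - \<theta> m \<omega>) * cdf F0 z + \<theta> m \<omega> * cdf (F1 (\<gamma> m \<omega>)) z"
    and cond_distribution_p_gamma:
      "\<And>m z. m \<in> {1..M} \<Longrightarrow>
         AE \<omega> in \<Omega>.
           real_cond_exp \<Omega> (sigma_gen \<Omega> borel (\<lambda>\<omega>. (p m \<omega>, \<gamma> m \<omega>)))
             (indicator {\<omega> \<in> space \<Omega>. Z m \<omega> \<le> z}) \<omega>
           = (1 - p m \<omega>) * cdf F0 z + p m \<omega> * cdf (F1 (\<gamma> m \<omega>)) z"
    and p_gamma_independent:
      "\<And>m. m \<in> {1..M} \<Longrightarrow> indep_var borel (\<gamma> m) borel (p m)"
    and gamma_finite_variance:
      "\<And>m. m \<in> {1..M} \<Longrightarrow> integrable \<Omega> (\<lambda>\<omega>. (\<gamma> m \<omega>)\<^sup>2)"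
    and p_mean: "\<And>m. m \<in> {1..M} \<Longrightarrow> expectation (p m) = 1 - a0"
    and a0_range: "1 - a0 \<in> {0<..<1}"

text \<open>
  A decision function is written \<open>d z t\<close>, with observation \<open>z\<close> and size threshold \<open>t\<close>.
  The expectation given \<open>\<theta> = 0\<close> is the integral with respect to \<open>F0\<close>.
\<close>

definition NS_decision ::
  "'w measure \<Rightarrow> ('w \<Rightarrow> real) \<Rightarrow> real measure \<Rightarrow> (real \<Rightarrow> real \<Rightarrow> real) \<Rightarrow> bool" where
  "NS_decision \<Omega> Y F0 d \<longleftrightarrow>
     (\<forall>t\<in>{0..1}. (\<lambda>z. d z t) \<in> borel_measurable borel \<and> (\<forall>z. d z t \<in> {0, 1})) \<and>
     (AE \<omega> in \<Omega>. mono_on {0..1} (d (Y \<omega>)) \<and>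
        (\<forall>t\<in>{0..<1}. continuous (at_right t) (d (Y \<omega>))) \<and>
        d (Y \<omega>) 0 = 0 \<and> d (Y \<omega>) 1 = 1) \<and>
     continuous_on {0<..<1} (\<lambda>t. \<integral>\<omega>. d (Y \<omega>) t \<partial>\<Omega>) \<and>
     strict_mono_on {0<..<1} (\<lambda>t. \<integral>\<omega>. d (Y \<omega>) t \<partial>\<Omega>) \<and>
     (\<forall>t\<in>{0..1}. (\<integral>z. d z t \<partial>F0) = t)"

text \<open>
  The conditional expectation of the decision given \<open>\<theta> = 1\<close> and \<open>\<gamma> = g\<close>, in the
  regular version determined by the kernel, so that differentiating in \<open>t\<close> for fixed \<open>g\<close>
  is meaningful.
\<close>

definition power_fun ::
  "(real \<Rightarrow> real measure) \<Rightarrow> (real \<Rightarrow> real \<Rightarrow> real) \<Rightarrow> real \<Rightarrow> real \<Rightarrow> real" where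
  "power_fun F1 d g t = (\<integral>z. d z t \<partial>(F1 g))"

definition strictly_concave_on :: "real set \<Rightarrow> (real \<Rightarrow> real) \<Rightarrow> bool" where
  "strictly_concave_on S f \<longleftrightarrow> convex S \<and>
     (\<forall>x\<in>S. \<forall>y\<in>S. \<forall>u\<in>{0<..<1}. x \<noteq> y \<longrightarrow>
        (1 - u) * f x + u * f y < f ((1 - u) * x + u * y))"

text \<open>
  Concavity is strict and is required on the whole threshold range \<open>{0..1}\<close>.  An affine piece
  of the power function would allow several maximisers, and a jump of the power function at
  threshold 1 could move the maximum to the boundary.
\<close>

definition A1 :: "(real \<Rightarrow> real) \<Rightarrow> bool" where
  "A1 \<pi> \<longleftrightarrow> strictly_concave_on {0..1} \<pi> \<and>
     (\<forall>t\<in>{0<..<1}. \<pi> differentiable (at t) \<and> deriv \<pi> differentiable (at t)) \<and>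
     (deriv \<pi> \<longlongrightarrow> 0) (at_left 1) \<and>
     filterlim (deriv \<pi>) at_top (at_right 0)"

definition mean_power ::
  "nat \<Rightarrow> (real \<Rightarrow> real measure) \<Rightarrow> (nat \<Rightarrow> real \<Rightarrow> real \<Rightarrow> real) \<Rightarrow>
   (nat \<Rightarrow> real) \<Rightarrow> (nat \<Rightarrow> real) \<Rightarrow> (nat \<Rightarrow> real) \<Rightarrow> real" where
  "mean_power M F1 \<delta> \<tau> q g = (\<Sum>m\<in>{1..M}. q m * power_fun F1 (\<delta> m) (g m) (\<tau> m))"

definition thresholds :: "nat \<Rightarrow> (nat \<Rightarrow> real) set" where
  "thresholds M = {1..M} \<rightarrow>\<^sub>E {0..1}"

definition feasible :: "nat \<Rightarrow> real \<Rightarrow> (nat \<Rightarrow> real) set" where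
  "feasible M t = {\<tau> \<in> thresholds M. (\<Sum>m\<in>{1..M}. \<tau> m) / real M = t}"

end

theory Submission
  imports Defs
begin

text \<open>
  Optimisation.  Each marginal power is a decreasing bijection from \<open>(0, 1)\<close> onto
  \<open>(0, \<infinity>)\<close>, so the intermediate value theorem gives a multiplier \<open>k\<close> for which the
  points with \<open>p\<^sub>m \<pi>'(t\<^sub>m) = k\<close> satisfy the constraint.  Strict concavity puts each power
  function strictly below its tangent at \<open>t\<^sub>m\<close>; summed over \<open>m\<close>, the linear terms cancel on the
  constraint set, so every other feasible point does strictly worse.

  Conditional expectation.  Comparing the two conditional laws of \<open>Z\<^sub>m\<close> through the tower property
  gives \<open>(E[\<theta>\<^sub>m | p\<^sub>m, \<gamma>\<^sub>m] - p\<^sub>m) (F\<^sub>1(z | \<gamma>\<^sub>m) - F\<^sub>0(z)) = 0\<close> for all \<open>z\<close>.  Since (A1) rules out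
  \<open>F\<^sub>1 = F\<^sub>0\<close>, this forces \<open>E[\<theta>\<^sub>m | p\<^sub>m, \<gamma>\<^sub>m] = p\<^sub>m\<close>.  Independence over \<open>m\<close> and a Dynkin argument
  on rectangles then replace \<open>(p\<^sub>m, \<gamma>\<^sub>m)\<close> by the whole family \<open>(\<^bold>p, \<^bold>\<gamma>)\<close> in the conditioning.
\<close>

section \<open>Allocation of thresholds under strict concavity\<close>

lemma strictly_concave_onD:
  assumes "strictly_concave_on S f" "x \<in> S" "y \<in> S" "x \<noteq> y" "0 < u" "u < 1"
  shows "(1 - u) * f x + u * f y < f ((1 - u) * x + u * y)"
  using assms by (simp add: strictly_concave_on_def)

text \<open>Convexity of \<open>-f\<close> yields only the weak tangent inequality. Strictness comes
  from the midpoint of \<open>x\<close> and \<open>y\<close>: there \<open>f\<close> lies strictly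
  above the chord yet weakly below the tangent, which is affine.\<close>

lemma strictly_concave_below_tangent:
  assumes f: "strictly_concave_on {0..1} f"
    and D: "(f has_real_derivative D) (at x)"
    and x: "x \<in> {0<..<1}" and y: "y \<in> {0..1}" "y \<noteq> x"
  shows "f y < f x + D * (y - x)"
proof -
  have conv: "convex_on {0..1} (\<lambda>x. - f x)"
  proof (rule convex_onI)
    fix u a b :: real
    assume "0 < u" "u < 1" "a \<in> {0..1}" "b \<in> {0..1}"
    then have "(1 - u) * f a + u * f b \<le> f ((1 - u) * a + u * b)"
      using f by (cases "a = b") (auto simp: strictly_concave_on_def less_imp_le algebra_simps)
    then show "- f ((1 - u) *\<^sub>R a + u *\<^sub>R b) \<le> (1 - u) * - f a + u * - f b"
      by simp
  qed simp
  have tangent: "f z \<le> f x + D * (z - x)" if "z \<in> {0..1}" for z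
  proof -
    have "((\<lambda>x. - f x) has_real_derivative - D) (at x within {0..1})"
      using DERIV_minus[OF D] by (rule has_field_derivative_at_within)
    then have "- D * (z - x) \<le> - f z - - f x"
      using x that by (intro convex_on_imp_above_tangent[OF conv]) auto
    then show ?thesis by simp
  qed
  define z where "z = (x + y) / 2"
  have "(1 - 1/2) * f x + 1/2 * f y < f ((1 - 1/2) * x + 1/2 * y)"
    by (rule strictly_concave_onD[OF f]) (use x y in auto)
  also have "(1 - 1/2) * x + 1/2 * y = z" by (simp add: z_def field_simps)
  also have "f z \<le> f x + D * (z - x)"
    using x y by (intro tangent) (auto simp: z_def)
  also have "\<dots> = f x + D * (y - x) / 2" by (simp add: z_def field_simps)
  finally show ?thesis by simp
qed

section \<open>Marginal power under (A1)\<close>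

lemma A1_has_deriv:
  assumes "A1 f" "x \<in> {0<..<1}"
  shows "(f has_real_derivative deriv f x) (at x)"
  using assms by (simp add: A1_def DERIV_deriv_iff_real_differentiable)

lemma A1_below_tangent:
  assumes "A1 f" "x \<in> {0<..<1}" "y \<in> {0..1}" "y \<noteq> x"
  shows "f y < f x + deriv f x * (y - x)"
proof (rule strictly_concave_below_tangent[OF _ A1_has_deriv])
  show "strictly_concave_on {0..1} f" using assms(1) by (simp add: A1_def)
qed (use assms in auto)

text \<open>Adding the tangent inequality at \<open>x\<close>, evaluated at \<open>y\<close>, to the
  one at \<open>y\<close>, evaluated at \<open>x\<close>, cancels the values of
  \<open>f\<close>.\<close>

lemma A1_deriv_strict_antimono:
  assumes "A1 f" "x \<in> {0<..<1}" "y \<in> {0<..<1}" "x < y"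
  shows "deriv f y < deriv f x"
proof -
  have "0 < (deriv f x - deriv f y) * (y - x)"
    using A1_below_tangent[of f x y] A1_below_tangent[of f y x] assms
    by (simp add: algebra_simps)
  then show ?thesis using assms(4) by (simp add: zero_less_mult_iff)
qed

lemma A1_isCont_deriv:
  assumes "A1 f" "x \<in> {0<..<1}"
  shows "isCont (deriv f) x"
  using assms by (simp add: A1_def differentiable_imp_continuous_within)

lemma A1_deriv_pos:
  assumes f: "A1 f" and x: "x \<in> {0<..<1}"
  shows "0 < deriv f x"
proof -
  \<comment> \<open>A limit preserves only the weak inequality \<open>0 \<le> deriv f y\<close>;
    strict decrease from \<open>x\<close> to this intermediate point then makes
    \<open>deriv f x\<close> positive.\<close>
  define y where "y = (x + 1) / 2"
  have y: "y \<in> {0<..<1}" "x < y" using x by (auto simp: y_def)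
  have "0 \<le> deriv f y"
  proof (rule tendsto_upperbound)
    show "(deriv f \<longlongrightarrow> 0) (at_left 1)" using f by (simp add: A1_def)
    show "eventually (\<lambda>z. deriv f z \<le> deriv f y) (at_left 1)"
      using y A1_deriv_strict_antimono[OF f y(1)]
      by (intro eventually_at_leftI[of y]) (auto intro: less_imp_le)
  qed simp
  with A1_deriv_strict_antimono[OF f x y] show ?thesis by simp
qed

text \<open>The derivative is continuous, being itself differentiable, and its limits at 0 and 1 are
  infinity and 0, so intermediate values are attained.\<close>

lemma A1_deriv_surj:
  assumes f: "A1 f" and c: "0 < c"
  shows "\<exists>x\<in>{0<..<1}. deriv f x = c"
proof -
  \<comment> \<open>Cutting at 1/2 guarantees \<open>a < b\<close> for the two points between which
    the intermediate value theorem is applied.\<close>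
  have "eventually (\<lambda>x. deriv f x < c \<and> x \<in> {1/2<..<1}) (at_left 1)"
  proof (rule eventually_conj)
    show "eventually (\<lambda>x. deriv f x < c) (at_left 1)"
      using f c by (intro order_tendstoD) (auto simp: A1_def)
  qed (rule eventually_at_leftI[of "1/2"]; simp)
  then obtain b where b: "deriv f b < c" "1/2 < b" "b < 1"
    using eventually_happens' [OF trivial_limit_at_left_real] by auto
  have "eventually (\<lambda>x. c < deriv f x \<and> x \<in> {0<..<1/2}) (at_right 0)"
  proof (rule eventually_conj)
    show "eventually (\<lambda>x. c < deriv f x) (at_right 0)"
      using f by (simp add: A1_def filterlim_at_top_dense)
  qed (rule eventually_at_rightI[of _ "1/2"]; simp)
  then obtain a where a: "c < deriv f a" "0 < a" "a < 1/2"
    using eventually_happens' [OF trivial_limit_at_right_real] by auto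
  have "\<exists>x\<ge>a. x \<le> b \<and> deriv f x = c"
    using a b A1_isCont_deriv[OF f] by (intro IVT2) auto
  with a b show ?thesis by force
qed

text \<open>\<open>g c\<close> is the threshold whose marginal power is \<open>c\<close>. Continuity
  of \<open>g\<close> later makes the total threshold continuous in the multiplier.\<close>

lemma A1_deriv_inverse:
  assumes f: "A1 f"
  obtains g where "\<And>c. 0 < c \<Longrightarrow> g c \<in> {0<..<1}" "\<And>c. 0 < c \<Longrightarrow> deriv f (g c) = c"
    "\<And>c. 0 < c \<Longrightarrow> isCont g c"
proof -
  define g where "g = inv_into {0<..<1} (deriv f)"
  have g: "g c \<in> {0<..<1}" "deriv f (g c) = c" if "0 < c" for c
  proof -
    have "c \<in> deriv f ` {0<..<1}" using A1_deriv_surj[OF f that] by auto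
    then show "g c \<in> {0<..<1}" "deriv f (g c) = c"
      unfolding g_def by (rule inv_into_into, rule f_inv_into_f)
  qed
  have inj: "inj_on (deriv f) {0<..<1}"
    using A1_deriv_strict_antimono[OF f] by (intro linorder_inj_onI) force+
  have "isCont g c" if "0 < c" for c
  proof -
    define x where "x = g c"
    have x: "x \<in> {0<..<1}" "deriv f x = c" using g[OF that] by (auto simp: x_def)
    \<comment> \<open>The interval from \<open>x / 2\<close> to \<open>(x + 1) / 2\<close> is a
      closed neighbourhood of \<open>x\<close> inside the open unit interval, where the derivative
      is continuous and injective.\<close>
    have "isCont g (deriv f x)"
    proof (rule isCont_inverse_function2[of "x / 2" x "(x + 1) / 2"])
      fix z assume "x / 2 \<le> z" "z \<le> (x + 1) / 2"
      with x have z: "z \<in> {0<..<1}" by auto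
      show "g (deriv f z) = z" unfolding g_def by (rule inv_into_f_f[OF inj z])
      show "isCont (deriv f) z" by (rule A1_isCont_deriv[OF f z])
    qed (use x in auto)
    with x show ?thesis by simp
  qed
  with g that show thesis by blast
qed

section \<open>The multiplier and the optimal allocation\<close>

lemma equal_marginal_gains_exist:
  fixes f :: "nat \<Rightarrow> real \<Rightarrow> real" and q :: "nat \<Rightarrow> real"
  assumes M: "1 \<le> M" and t: "t \<in> {0<..<1}"
    and f: "\<And>m. m \<in> {1..M} \<Longrightarrow> A1 (f m)" and q: "\<And>m. m \<in> {1..M} \<Longrightarrow> 0 < q m"
  obtains k x where "0 < k" "\<And>m. m \<in> {1..M} \<Longrightarrow> x m \<in> {0<..<1}"
    "\<And>m. m \<in> {1..M} \<Longrightarrow> deriv (f m) (x m) = k / q m" "(\<Sum>m\<in>{1..M}. x m) = real M * t"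
proof -
  have "\<exists>g. \<forall>c>0. g c \<in> {0<..<1} \<and> deriv (f m) (g c) = c \<and> isCont g c" if m: "m \<in> {1..M}" for m
    by (rule A1_deriv_inverse[OF f[OF m]]) metis
  then obtain g where g: "\<And>m c. m \<in> {1..M} \<Longrightarrow> 0 < c \<Longrightarrow>
      g m c \<in> {0<..<1} \<and> deriv (f m) (g m c) = c \<and> isCont (g m) c"
    by metis
  define S where "S k = (\<Sum>m\<in>{1..M}. g m (k / q m))" for k
  \<comment> \<open>\<open>K\<close> collects, for each \<open>m\<close>, the multiplier at which
    coordinate \<open>m\<close> chooses exactly \<open>t\<close>. At \<open>Min K\<close> every
    coordinate chooses at least \<open>t\<close>, at \<open>Max K\<close> at most \<open>t\<close>,
    so the total \<open>S\<close> crosses \<open>real M * t\<close> in between.\<close>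
  define K where "K = (\<lambda>m. q m * deriv (f m) t) ` {1..M}"
  have K: "finite K" "K \<noteq> {}" using M by (auto simp: K_def)
  have K_pos: "0 < k" if "k \<in> K" for k
    using that q A1_deriv_pos[OF f t] by (auto simp: K_def)
  have cont: "isCont S k" if "0 < k" for k
    unfolding S_def
  proof (rule continuous_sum)
    fix m assume m: "m \<in> {1..M}"
    have "isCont (\<lambda>k. k / q m) k" using q[OF m] by (intro continuous_intros) auto
    moreover have "isCont (g m) (k / q m)" using g[OF m] that q[OF m] by simp
    ultimately show "isCont (\<lambda>k. g m (k / q m)) k" by (rule isCont_o2)
  qed
  have lo: "t \<le> g m (Min K / q m)" if m: "m \<in> {1..M}" for m
  proof (rule ccontr)
    assume *: "\<not> t \<le> g m (Min K / q m)"
    have pos: "0 < Min K / q m" using K_pos Min_in[OF K] q[OF m] by simp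
    have "deriv (f m) t < Min K / q m"
      using A1_deriv_strict_antimono[OF f[OF m], of "g m (Min K / q m)" t] g[OF m pos] t * by auto
    moreover have "Min K \<le> q m * deriv (f m) t" using K m by (auto simp: K_def intro!: Min_le)
    ultimately show False using q[OF m] by (simp add: field_simps)
  qed
  have hi: "g m (Max K / q m) \<le> t" if m: "m \<in> {1..M}" for m
  proof (rule ccontr)
    assume *: "\<not> g m (Max K / q m) \<le> t"
    have pos: "0 < Max K / q m" using K_pos Max_in[OF K] q[OF m] by simp
    have "Max K / q m < deriv (f m) t"
      using A1_deriv_strict_antimono[OF f[OF m], of t "g m (Max K / q m)"] g[OF m pos] t * by auto
    moreover have "q m * deriv (f m) t \<le> Max K" using K m by (auto simp: K_def intro!: Max_ge)
    ultimately show False using q[OF m] by (simp add: field_simps)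
  qed
  have "\<exists>k\<ge>Min K. k \<le> Max K \<and> S k = real M * t"
  proof (rule IVT2)
    show "S (Max K) \<le> real M * t"
      using sum_mono[of "{1..M}", OF hi] by (simp add: S_def)
    show "real M * t \<le> S (Min K)"
      using sum_mono[of "{1..M}", OF lo] by (simp add: S_def)
    show "Min K \<le> Max K" using K by (meson Max_ge Min_in)
    show "\<forall>x. Min K \<le> x \<and> x \<le> Max K \<longrightarrow> isCont S x"
      using cont K_pos[OF Min_in[OF K]] by auto
  qed
  then obtain k where k: "Min K \<le> k" "S k = real M * t" by blast
  have k_pos: "0 < k" using k K_pos[OF Min_in[OF K]] by simp
  show thesis
    by (rule that[of k "\<lambda>m. g m (k / q m)"]) (use k k_pos g q in \<open>auto simp: S_def\<close>)
qed

text \<open>Weighting the tangent at \<open>x m\<close> by \<open>q m\<close> turns its slope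
  \<open>k / q m\<close> into the common slope \<open>k\<close>, the Lagrange multiplier of the
  constraint.\<close>

lemma unique_optimal_thresholds:
  fixes f :: "nat \<Rightarrow> real \<Rightarrow> real" and q :: "nat \<Rightarrow> real"
  assumes M: "1 \<le> M" and t: "t \<in> {0<..<1}"
    and f: "\<And>m. m \<in> {1..M} \<Longrightarrow> A1 (f m)" and q: "\<And>m. m \<in> {1..M} \<Longrightarrow> 0 < q m"
  shows "\<exists>\<tau>. (\<forall>\<sigma>. is_arg_max (\<lambda>\<sigma>. \<Sum>m\<in>{1..M}. q m * f m (\<sigma> m)) (\<lambda>\<sigma>. \<sigma> \<in> feasible M t) \<sigma> \<longleftrightarrow> \<sigma> = \<tau>)
    \<and> (\<exists>k>0. \<forall>m\<in>{1..M}. \<tau> m \<in> {0<..<1} \<and> deriv (f m) (\<tau> m) = k / q m)"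
proof -
  obtain k x where k: "0 < k" and x: "\<And>m. m \<in> {1..M} \<Longrightarrow> x m \<in> {0<..<1}"
    and deriv_x: "\<And>m. m \<in> {1..M} \<Longrightarrow> deriv (f m) (x m) = k / q m"
    and sum_x: "(\<Sum>m\<in>{1..M}. x m) = real M * t"
    by (rule equal_marginal_gains_exist[of M t f q]) (use M t f q in auto)
  \<comment> \<open>Feasible vectors are extensional functions, so the candidate is restricted to
    the index set; uniqueness is then plain equality of functions.\<close>
  define \<tau> where "\<tau> = restrict x {1..M}"
  let ?P = "\<lambda>\<sigma>. \<Sum>m\<in>{1..M}. q m * f m (\<sigma> m)"
  have \<tau>: "\<tau> \<in> feasible M t"
    using x sum_x M by (auto simp: \<tau>_def feasible_def thresholds_def less_imp_le)
  have less: "?P \<sigma> < ?P \<tau>" if \<sigma>: "\<sigma> \<in> feasible M t" "\<sigma> \<noteq> \<tau>" for \<sigma>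
  proof -
    have range: "\<sigma> m \<in> {0..1}" if "m \<in> {1..M}" for m
      using \<sigma>(1) that by (auto simp: feasible_def thresholds_def)
    have sum_\<sigma>: "(\<Sum>m\<in>{1..M}. \<sigma> m) = real M * t"
      using \<sigma>(1) M by (auto simp: feasible_def field_simps)
    have strict: "q m * f m (\<sigma> m) < q m * f m (x m) + k * (\<sigma> m - x m)"
      if m: "m \<in> {1..M}" and "\<sigma> m \<noteq> x m" for m
    proof -
      have "f m (\<sigma> m) < f m (x m) + k / q m * (\<sigma> m - x m)"
        using A1_below_tangent[OF f[OF m] x[OF m] range[OF m]] that deriv_x[OF m] by simp
      then have "q m * f m (\<sigma> m) < q m * (f m (x m) + k / q m * (\<sigma> m - x m))"
        using q[OF m] by (rule mult_strict_left_mono)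
      also have "\<dots> = q m * f m (x m) + k * (\<sigma> m - x m)"
        using q[OF m] by (simp add: field_simps)
      finally show ?thesis .
    qed
    have neq: "\<exists>m\<in>{1..M}. \<sigma> m \<noteq> x m"
    proof (rule ccontr)
      assume "\<not> ?thesis"
      then have "\<sigma> = \<tau>"
        using \<sigma>(1) by (intro PiE_ext[of _ "{1..M}" "\<lambda>_. {0..1}"])
          (use \<tau> in \<open>auto simp: \<tau>_def feasible_def thresholds_def\<close>)
      with \<sigma>(2) show False by simp
    qed
    \<comment> \<open>Coordinates that agree with \<open>x\<close> give equality, so the strict
      inequality rests on one coordinate that differs.\<close>
    have "?P \<sigma> < (\<Sum>m\<in>{1..M}. q m * f m (x m) + k * (\<sigma> m - x m))"
    proof (intro sum_strict_mono_ex1 ballI)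
      fix m assume "m \<in> {1..M}"
      with strict[of m] show "q m * f m (\<sigma> m) \<le> q m * f m (x m) + k * (\<sigma> m - x m)"
        by (cases "\<sigma> m = x m") auto
    next
      show "\<exists>m\<in>{1..M}. q m * f m (\<sigma> m) < q m * f m (x m) + k * (\<sigma> m - x m)"
        using strict neq by blast
    qed simp
    also have "\<dots> = ?P x + k * ((\<Sum>m\<in>{1..M}. \<sigma> m) - (\<Sum>m\<in>{1..M}. x m))"
      by (simp add: sum.distrib sum_distrib_left sum_subtractf right_diff_distrib)
    \<comment> \<open>Both threshold sums equal \<open>real M * t\<close>, so the linear part
      vanishes.\<close>
    also have "\<dots> = ?P \<tau>" using sum_x sum_\<sigma> by (simp add: \<tau>_def)
    finally show ?thesis .
  qed
  have "is_arg_max ?P (\<lambda>\<sigma>. \<sigma> \<in> feasible M t) \<sigma> \<longleftrightarrow> \<sigma> = \<tau>" for \<sigma>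
  proof
    assume "is_arg_max ?P (\<lambda>\<sigma>. \<sigma> \<in> feasible M t) \<sigma>"
    then have "\<sigma> \<in> feasible M t" "\<not> ?P \<sigma> < ?P \<tau>" using \<tau> by (auto simp: is_arg_max_def)
    with less show "\<sigma> = \<tau>" by blast
  next
    assume "\<sigma> = \<tau>"
    moreover have "\<not> ?P \<tau> < ?P \<rho>" if "\<rho> \<in> feasible M t" for \<rho>
      using less[OF that] by (cases "\<rho> = \<tau>") auto
    ultimately show "is_arg_max ?P (\<lambda>\<sigma>. \<sigma> \<in> feasible M t) \<sigma>"
      using \<tau> by (auto simp: is_arg_max_def)
  qed
  moreover have "\<forall>m\<in>{1..M}. \<tau> m \<in> {0<..<1} \<and> deriv (f m) (\<tau> m) = k / q m"
    using x deriv_x by (auto simp: \<tau>_def)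
  ultimately show ?thesis using k by blast
qed

section \<open>Conditional power of a single decision\<close>

text \<open>For fixed \<omega> the set function \<open>h \<omega>\<close> behaves like a signed
  measure, and the sets with vanishing integral form a Dynkin system. The principle serves twice:
  for half-lines generating the Borel sets and for rectangles generating a product.\<close>

lemma integral_signed_kernel_eq_0:
  fixes h :: "'w \<Rightarrow> 'x set \<Rightarrow> real"
  assumes G: "Int_stable G" "G \<subseteq> Pow X"
    and w: "integrable N w"
    and meas: "\<And>A. A \<in> sigma_sets X G \<Longrightarrow> (\<lambda>\<omega>. h \<omega> A) \<in> borel_measurable N"
    and bound: "\<And>A \<omega>. A \<in> sigma_sets X G \<Longrightarrow> \<omega> \<in> space N \<Longrightarrow> \<bar>h \<omega> A\<bar> \<le> w \<omega>"
    and additive: "\<And>A \<omega>. range A \<subseteq> sigma_sets X G \<Longrightarrow> disjoint_family A \<Longrightarrow> \<omega> \<in> space N \<Longrightarrow>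
      (\<lambda>i. h \<omega> (A i)) sums h \<omega> (\<Union>i. A i)"
    and generator: "\<And>A. A \<in> G \<Longrightarrow> (\<integral>\<omega>. h \<omega> A \<partial>N) = 0"
    and total: "(\<integral>\<omega>. h \<omega> X \<partial>N) = 0"
    and A: "A \<in> sigma_sets X G"
  shows "(\<integral>\<omega>. h \<omega> A \<partial>N) = 0"
proof -
  interpret S: sigma_algebra X "sigma_sets X G"
    using G(2) by (rule sigma_algebra_sigma_sets)
  \<comment> \<open>Countable additivity on a sequence of empty sets gives a convergent series with
    constant terms.\<close>
  have h_empty: "h \<omega> {} = 0" if "\<omega> \<in> space N" for \<omega>
  proof -
    have "(\<lambda>i::nat. h \<omega> {}) sums h \<omega> (\<Union>i::nat. {})"
      using that by (intro additive) (auto simp: disjoint_family_on_def)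
    then show ?thesis using summable_const_iff sums_summable by blast
  qed
  have split: "h \<omega> X = h \<omega> B + h \<omega> (X - B)" if "\<omega> \<in> space N" "B \<in> sigma_sets X G" for \<omega> B
  proof -
    have "(\<lambda>i. h \<omega> (binaryset B (X - B) i)) sums h \<omega> (\<Union>i. binaryset B (X - B) i)"
      using that by (intro additive)
        (auto simp: range_binaryset_eq disjoint_family_on_def binaryset_def split: if_splits)
    moreover have "(\<lambda>i. h \<omega> (binaryset B (X - B) i)) sums (h \<omega> B + h \<omega> (X - B))"
      using h_empty[OF that(1)] by (rule binaryset_sums)
    moreover have "(\<Union>i. binaryset B (X - B) i) = X"
      using S.sets_into_space[OF that(2)] by (auto simp: UN_binaryset_eq)
    ultimately show ?thesis by (simp add: sums_unique2)
  qed
  have int: "integrable N (\<lambda>\<omega>. h \<omega> B)" if "B \<in> sigma_sets X G" for B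
    by (rule Bochner_Integration.integrable_bound[OF w meas[OF that]])
      (use bound[OF that] in \<open>force intro: AE_I2\<close>)
  show ?thesis
    using G A
  proof (induction rule: sigma_sets_induct_disjoint)
    case (basic A)
    then show ?case by (rule generator)
  next
    case empty
    show ?case using h_empty by (simp cong: Bochner_Integration.integral_cong)
  next
    case (compl A)
    have "(\<integral>\<omega>. h \<omega> X \<partial>N) = (\<integral>\<omega>. h \<omega> A + h \<omega> (X - A) \<partial>N)"
      using split[OF _ compl(1)] by (intro Bochner_Integration.integral_cong) auto
    also have "\<dots> = (\<integral>\<omega>. h \<omega> A \<partial>N) + (\<integral>\<omega>. h \<omega> (X - A) \<partial>N)"
      using compl by (intro Bochner_Integration.integral_add int) auto
    finally show ?case using total compl by simp
  next
    case (union A)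
    have A: "A i \<in> sigma_sets X G" for i using union by auto
    \<comment> \<open>A partial sum is the value on a finite union, hence bounded by
      \<open>w\<close> itself and not merely by \<open>n\<close> times \<open>w\<close>; this makes
      dominated convergence applicable.\<close>
    have partial: "(\<Sum>i<n. h \<omega> (A i)) = h \<omega> (\<Union>i<n. A i)" if "\<omega> \<in> space N" for n \<omega>
    proof -
      define A' where "A' i = (if i < n then A i else {})" for i
      have "(\<lambda>i. h \<omega> (A' i)) sums h \<omega> (\<Union>i. A' i)"
        using that union A by (intro additive) (auto simp: A'_def disjoint_family_on_def)
      moreover have "(\<lambda>i. h \<omega> (A' i)) sums (\<Sum>i<n. h \<omega> (A' i))"
        using h_empty[OF that] by (intro sums_finite) (auto simp: A'_def)
      moreover have "(\<Union>i. A' i) = (\<Union>i<n. A i)" by (auto simp: A'_def split: if_splits)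
      ultimately show ?thesis by (simp add: sums_unique2 A'_def)
    qed
    have "(\<lambda>n. \<integral>\<omega>. (\<Sum>i<n. h \<omega> (A i)) \<partial>N) \<longlonglongrightarrow> (\<integral>\<omega>. h \<omega> (\<Union>i. A i) \<partial>N)"
    proof (rule integral_dominated_convergence[where w = w])
      show "AE \<omega> in N. (\<lambda>n. \<Sum>i<n. h \<omega> (A i)) \<longlonglongrightarrow> h \<omega> (\<Union>i. A i)"
        using additive[OF union(2,1)] by (auto simp: sums_def)
      fix n
      have "(\<Union>i<n. A i) \<in> sigma_sets X G" using A by auto
      from bound[OF this] show "AE \<omega> in N. norm (\<Sum>i<n. h \<omega> (A i)) \<le> w \<omega>"
        by (auto simp: partial)
    qed (use A in \<open>auto intro!: meas w borel_measurable_sum\<close>)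
    moreover have "(\<integral>\<omega>. (\<Sum>i<n. h \<omega> (A i)) \<partial>N) = 0" for n
      using int[OF A] union(3) by (simp add: Bochner_Integration.integral_sum)
    ultimately show ?case by (simp add: LIMSEQ_const_iff)
  qed
qed

section \<open>Sigma-algebras generated by random variables\<close>

lemma subalgebra_sigma_gen:
  assumes "X \<in> measurable \<Omega> N"
  shows "subalgebra \<Omega> (sigma_gen \<Omega> N X)"
  unfolding subalgebra_def sigma_gen_def using assms by (simp add: sets_image_in_sets)

lemma space_sigma_gen: "space (sigma_gen \<Omega> N X) = space \<Omega>"
  by (simp add: sigma_gen_def)

lemma measurable_sigma_gen:
  assumes "X \<in> measurable \<Omega> N"
  shows "X \<in> measurable (sigma_gen \<Omega> N X) N"
  unfolding sigma_gen_def using measurable_space[OF assms] by (intro measurable_vimage_algebra1) auto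

lemma measurable_sigma_gen_compose:
  assumes "X \<in> measurable \<Omega> N" "f \<in> measurable N L"
  shows "(\<lambda>\<omega>. f (X \<omega>)) \<in> measurable (sigma_gen \<Omega> N X) L"
  using measurable_sigma_gen[OF assms(1)] assms(2) by (rule measurable_compose)

lemma sets_sigma_gen_iff:
  assumes "X \<in> measurable \<Omega> N"
  shows "A \<in> sets (sigma_gen \<Omega> N X) \<longleftrightarrow> (\<exists>B\<in>sets N. A = X -` B \<inter> space \<Omega>)"
  unfolding sigma_gen_def using measurable_space[OF assms] by (subst sets_vimage_algebra2) auto

lemma borel_measurable_pair_components:
  "(\<lambda>x::real \<times> real. fst x) \<in> borel_measurable borel"
  "(\<lambda>x::real \<times> real. snd x) \<in> borel_measurable borel"
  by (auto intro!: borel_measurable_continuous_onI continuous_intros)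

lemma borel_measurable_triple_components:
  "(\<lambda>x::real \<times> real \<times> real. fst x) \<in> borel_measurable borel"
  "(\<lambda>x::real \<times> real \<times> real. fst (snd x)) \<in> borel_measurable borel"
  "(\<lambda>x::real \<times> real \<times> real. snd (snd x)) \<in> borel_measurable borel"
  by (auto intro!: borel_measurable_continuous_onI continuous_intros)

section \<open>A single observation from the mixture\<close>

text \<open>This is one coordinate of the model, with a kernel defined on all reals. The condition
  \<open>alternative_distinct\<close> is what allows the two conditional laws to identify the
  conditional mean of \<theta>.\<close>

locale mixture_observation = prob_space \<Omega> for \<Omega> :: "'w measure" +
  fixes Z \<theta> p \<gamma> :: "'w \<Rightarrow> real" and F0 :: "real measure" and K :: "real \<Rightarrow> real measure"
  assumes Z [measurable]: "Z \<in> borel_measurable \<Omega>"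
    and \<theta> [measurable]: "\<theta> \<in> borel_measurable \<Omega>"
    and p [measurable]: "p \<in> borel_measurable \<Omega>"
    and \<gamma> [measurable]: "\<gamma> \<in> borel_measurable \<Omega>"
    and F0: "F0 \<in> space (prob_algebra borel)"
    and K [measurable]: "K \<in> measurable borel (prob_algebra borel)"
    and range: "AE \<omega> in \<Omega>. \<theta> \<omega> \<in> {0, 1} \<and> p \<omega> \<in> {0..1}"
    and law_given_\<theta>_p_\<gamma>: "\<And>z. AE \<omega> in \<Omega>.
      real_cond_exp \<Omega> (sigma_gen \<Omega> borel (\<lambda>\<omega>. (\<theta> \<omega>, p \<omega>, \<gamma> \<omega>)))
        (indicator {\<omega> \<in> space \<Omega>. Z \<omega> \<le> z}) \<omega>
      = (1 - \<theta> \<omega>) * cdf F0 z + \<theta> \<omega> * cdf (K (\<gamma> \<omega>)) z"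
    and law_given_p_\<gamma>: "\<And>z. AE \<omega> in \<Omega>.
      real_cond_exp \<Omega> (sigma_gen \<Omega> borel (\<lambda>\<omega>. (p \<omega>, \<gamma> \<omega>)))
        (indicator {\<omega> \<in> space \<Omega>. Z \<omega> \<le> z}) \<omega>
      = (1 - p \<omega>) * cdf F0 z + p \<omega> * cdf (K (\<gamma> \<omega>)) z"
    and alternative_distinct: "AE \<omega> in \<Omega>. K (\<gamma> \<omega>) \<noteq> F0"
begin

abbreviation "H \<equiv> sigma_gen \<Omega> borel (\<lambda>\<omega>. (\<theta> \<omega>, p \<omega>, \<gamma> \<omega>))"
abbreviation "G \<equiv> sigma_gen \<Omega> borel (\<lambda>\<omega>. (p \<omega>, \<gamma> \<omega>))"

lemma triple_measurable: "(\<lambda>\<omega>. (\<theta> \<omega>, p \<omega>, \<gamma> \<omega>)) \<in> borel_measurable \<Omega>"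
  and pair_measurable: "(\<lambda>\<omega>. (p \<omega>, \<gamma> \<omega>)) \<in> borel_measurable \<Omega>"
  by measurable

lemma subalgebra_H: "subalgebra \<Omega> H" and subalgebra_G: "subalgebra \<Omega> G"
  using triple_measurable pair_measurable by (auto intro: subalgebra_sigma_gen)

lemma measurable_H:
  "\<theta> \<in> borel_measurable H" "p \<in> borel_measurable H" "\<gamma> \<in> borel_measurable H"
  using borel_measurable_triple_components[THEN measurable_sigma_gen_compose[OF triple_measurable]]
  by simp_all

lemma measurable_G: "p \<in> borel_measurable G" "\<gamma> \<in> borel_measurable G"
  using borel_measurable_pair_components[THEN measurable_sigma_gen_compose[OF pair_measurable]]
  by simp_all

text \<open>This inclusion carries the tower property: conditioning on \<open>H\<close>, which also
  reveals \<theta>, can be followed by conditioning on \<open>G\<close>.\<close>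

lemma subalgebra_H_G: "subalgebra H G"
proof -
  have "(\<lambda>\<omega>. (p \<omega>, \<gamma> \<omega>)) \<in> borel_measurable H"
    using measurable_H(2,3) by (rule borel_measurable_Pair)
  then show ?thesis
    unfolding subalgebra_def by (simp add: sets_image_in_sets space_sigma_gen sigma_gen_def[of _ _ "\<lambda>\<omega>. (p \<omega>, \<gamma> \<omega>)"])
qed

sublocale H: finite_measure_subalgebra \<Omega> H
  by standard (rule subalgebra_H)

sublocale G: finite_measure_subalgebra \<Omega> G
  by standard (rule subalgebra_G)

lemma prob_space_K: "prob_space (K g)" "sets (K g) = sets borel"
  using measurable_space[OF K, of g] by (auto simp: space_prob_algebra)

lemma prob_space_F0: "prob_space F0" "sets F0 = sets borel"
  using F0 by (auto simp: space_prob_algebra)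

lemma measure_K_bounds: "0 \<le> measure (K g) B" "measure (K g) B \<le> 1"
  using prob_space.prob_le_1[OF prob_space_K(1)] by auto

lemma measurable_measure_K:
  assumes "B \<in> sets borel"
  shows "(\<lambda>g. measure (K g) B) \<in> borel_measurable borel"
  using assms by measurable

lemma integrable_\<theta>_p: "integrable \<Omega> \<theta>" "integrable \<Omega> p"
proof -
  have "AE \<omega> in \<Omega>. norm (\<theta> \<omega>) \<le> 1" "AE \<omega> in \<Omega>. norm (p \<omega>) \<le> 1"
    using range by (eventually_elim, auto)+
  then show "integrable \<Omega> \<theta>" "integrable \<Omega> p"
    by (auto simp del: real_norm_def intro: integrable_const_bound \<theta> p)
qed

lemma integrable_mult_measure_K:
  assumes "integrable \<Omega> f" "B \<in> sets borel"
  shows "integrable \<Omega> (\<lambda>\<omega>. f \<omega> * measure (K (\<gamma> \<omega>)) B)"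
proof (rule Bochner_Integration.integrable_bound[OF assms(1)])
  have [measurable]: "f \<in> borel_measurable \<Omega>" using assms(1) by auto
  note [measurable] = measurable_measure_K[OF assms(2)]
  show "(\<lambda>\<omega>. f \<omega> * measure (K (\<gamma> \<omega>)) B) \<in> borel_measurable \<Omega>" by measurable
  show "AE \<omega> in \<Omega>. norm (f \<omega> * measure (K (\<gamma> \<omega>)) B) \<le> norm (f \<omega>)"
    using measure_K_bounds by (auto simp: abs_mult intro!: mult_left_le)
qed

text \<open>The model specifies the conditional law on half-lines only; the Dynkin principle extends
  it to Borel sets, which is needed because a rejection region can be any of them.\<close>

lemma law_given_\<theta>_p_\<gamma>_set:
  assumes B: "B \<in> sets borel"
  shows "AE \<omega> in \<Omega>. real_cond_exp \<Omega> H (\<lambda>\<omega>. indicator B (Z \<omega>)) \<omega>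
    = (1 - \<theta> \<omega>) * measure F0 B + \<theta> \<omega> * measure (K (\<gamma> \<omega>)) B"
proof -
  define mix where "mix \<omega> B = (1 - \<theta> \<omega>) * measure F0 B + \<theta> \<omega> * measure (K (\<gamma> \<omega>)) B" for \<omega> B
  have int_mix: "integrable \<Omega> (\<lambda>\<omega>. mix \<omega> B)" if "B \<in> sets borel" for B
    unfolding mix_def using that
    by (intro Bochner_Integration.integrable_add integrable_mult_measure_K integrable_mult_left
        Bochner_Integration.integrable_diff integrable_\<theta>_p) auto
  have mix_H: "(\<lambda>\<omega>. mix \<omega> B) \<in> borel_measurable H" if "B \<in> sets borel" for B
  proof -
    note [measurable] = measurable_H measurable_measure_K[OF that]
    show ?thesis unfolding mix_def by measurable
  qed
  have int_ind: "integrable \<Omega> (\<lambda>\<omega>. indicator B (Z \<omega>) :: real)" if [measurable]: "B \<in> sets borel" for B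
    by (rule integrable_const_bound[where B = 1]) (auto simp: indicator_def)
  \<comment> \<open>This is the characterising property of the conditional expectation, written as
    one integral so that the Dynkin principle can run in \<open>B\<close> for fixed
    \<open>A\<close>.\<close>
  have zero: "(\<integral>\<omega>. indicator A \<omega> * (indicator B (Z \<omega>) - mix \<omega> B) \<partial>\<Omega>) = 0"
    if A: "A \<in> sets H" and "B \<in> sets borel" for A B
  proof -
    let ?E = "range (\<lambda>a::real. {..a})"
    have borel: "sigma_sets UNIV ?E = sets borel"
      by (subst borel_eq_atMost) (simp add: sets_measure_of)
    have A_\<Omega> [measurable]: "A \<in> sets \<Omega>" using A subalgebra_H by (auto simp: subalgebra_def)
    have int: "integrable \<Omega> (\<lambda>\<omega>. indicator A \<omega> * (indicator B (Z \<omega>) - mix \<omega> B))"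
      if "B \<in> sets borel" for B
      using integrable_mult_indicator[OF A_\<Omega> Bochner_Integration.integrable_diff[OF int_ind int_mix], OF that that]
      by simp
    \<comment> \<open>The bound \<open>w\<close> contains absolute values because it has to hold at
      every point, whereas \<theta> lies in \<open>{0, 1}\<close> only almost everywhere.\<close>
    show ?thesis
    proof (rule integral_signed_kernel_eq_0[where G = ?E and X = UNIV and
          w = "\<lambda>\<omega>. 1 + \<bar>1 - \<theta> \<omega>\<bar> + \<bar>\<theta> \<omega>\<bar>" and
          h = "\<lambda>\<omega> B. indicator A \<omega> * (indicator B (Z \<omega>) - mix \<omega> B)"], unfold borel)
      show "Int_stable ?E" by (auto simp: Int_stable_def)
      show "integrable \<Omega> (\<lambda>\<omega>. 1 + \<bar>1 - \<theta> \<omega>\<bar> + \<bar>\<theta> \<omega>\<bar>)"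
        using integrable_\<theta>_p by (intro Bochner_Integration.integrable_add integrable_abs
            Bochner_Integration.integrable_diff) auto
    next
      fix B :: "real set" assume "B \<in> sets borel"
      from int[OF this] show "(\<lambda>\<omega>. indicator A \<omega> * (indicator B (Z \<omega>) - mix \<omega> B)) \<in> borel_measurable \<Omega>"
        by auto
    next
      fix B :: "real set" and \<omega> assume "B \<in> sets borel"
      have "\<bar>mix \<omega> B\<bar> \<le> \<bar>1 - \<theta> \<omega>\<bar> * \<bar>measure F0 B\<bar> + \<bar>\<theta> \<omega>\<bar> * \<bar>measure (K (\<gamma> \<omega>)) B\<bar>"
        unfolding mix_def by (rule order_trans[OF abs_triangle_ineq]) (simp add: abs_mult)
      also have "\<dots> \<le> \<bar>1 - \<theta> \<omega>\<bar> * 1 + \<bar>\<theta> \<omega>\<bar> * 1"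
        using measure_K_bounds prob_space.prob_le_1[OF prob_space_F0(1)]
        by (intro add_mono mult_left_mono) auto
      finally show "\<bar>indicator A \<omega> * (indicator B (Z \<omega>) - mix \<omega> B)\<bar> \<le> 1 + \<bar>1 - \<theta> \<omega>\<bar> + \<bar>\<theta> \<omega>\<bar>"
        by (auto simp: indicator_def)
    next
      fix C :: "nat \<Rightarrow> real set" and \<omega>
      assume C: "range C \<subseteq> sets borel" "disjoint_family C"
      have "(\<lambda>i. measure F0 (C i)) sums measure F0 (\<Union>i. C i)"
        "(\<lambda>i. measure (K (\<gamma> \<omega>)) (C i)) sums measure (K (\<gamma> \<omega>)) (\<Union>i. C i)"
        using C prob_space_F0 prob_space_K
        by (auto intro!: finite_measure.finite_measure_UNION prob_space.finite_measure)
      moreover have "(\<lambda>i. indicator (C i) (Z \<omega>) :: real) sums indicator (\<Union>i. C i) (Z \<omega>)"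
        using C(2) by (intro indicator_sums) (auto simp: disjoint_family_on_def)
      ultimately show "(\<lambda>i. indicator A \<omega> * (indicator (C i) (Z \<omega>) - mix \<omega> (C i))) sums
          (indicator A \<omega> * (indicator (\<Union>i. C i) (Z \<omega>) - mix \<omega> (\<Union>i. C i)))"
        unfolding mix_def by (intro sums_mult sums_diff sums_add)
    next
      fix B assume "B \<in> ?E"
      then obtain z where z: "B = {..z}" by auto
      have ind: "indicator {\<omega> \<in> space \<Omega>. Z \<omega> \<le> z} \<omega> = (indicator B (Z \<omega>) :: real)"
        if "\<omega> \<in> space \<Omega>" for \<omega>
        using that by (auto simp: z indicator_def)
      have "(\<integral>\<omega>\<in>A. indicator B (Z \<omega>) \<partial>\<Omega>) = (\<integral>\<omega>\<in>A. indicat_real {\<omega> \<in> space \<Omega>. Z \<omega> \<le> z} \<omega> \<partial>\<Omega>)"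
        using sets.sets_into_space[OF A_\<Omega>] ind by (intro set_lebesgue_integral_cong) auto
      also have "\<dots> = (\<integral>\<omega>\<in>A. real_cond_exp \<Omega> H (indicator {\<omega> \<in> space \<Omega>. Z \<omega> \<le> z}) \<omega> \<partial>\<Omega>)"
      proof (rule H.real_cond_exp_intA[OF _ A])
        have "{\<omega> \<in> space \<Omega>. Z \<omega> \<le> z} \<in> sets \<Omega>" by measurable
        then show "integrable \<Omega> (indicat_real {\<omega> \<in> space \<Omega>. Z \<omega> \<le> z})"
          by (simp add: emeasure_finite less_top[symmetric])
      qed
      also have "\<dots> = (\<integral>\<omega>\<in>A. mix \<omega> B \<partial>\<Omega>)"
        using law_given_\<theta>_p_\<gamma>[of z] int_mix[of B]
        by (intro set_lebesgue_integral_cong_AE) (auto simp: mix_def z cdf_def elim!: eventually_mono)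
      finally show "(\<integral>\<omega>. indicator A \<omega> * (indicator B (Z \<omega>) - mix \<omega> B) \<partial>\<Omega>) = 0"
        using integrable_mult_indicator[OF A_\<Omega> int_ind[of B]] integrable_mult_indicator[OF A_\<Omega> int_mix[of B]]
        by (simp add: set_lebesgue_integral_def right_diff_distrib z)
    next
      show "(\<integral>\<omega>. indicator A \<omega> * (indicator UNIV (Z \<omega>) - mix \<omega> UNIV) \<partial>\<Omega>) = 0"
        using prob_space.prob_space[OF prob_space_F0(1)] prob_space.prob_space[OF prob_space_K(1)]
          sets_eq_imp_space_eq[OF prob_space_F0(2)] sets_eq_imp_space_eq[OF prob_space_K(2)]
        by (simp add: mix_def)
    qed (use that in auto)
  qed
  have "AE \<omega> in \<Omega>. real_cond_exp \<Omega> H (\<lambda>\<omega>. indicator B (Z \<omega>)) \<omega> = mix \<omega> B"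
  proof (rule H.real_cond_exp_charact)
    fix A assume A: "A \<in> sets H"
    then have "A \<in> sets \<Omega>" using subalgebra_H by (auto simp: subalgebra_def)
    with zero[OF A B] show "(\<integral>\<omega>\<in>A. indicator B (Z \<omega>) \<partial>\<Omega>) = (\<integral>\<omega>\<in>A. mix \<omega> B \<partial>\<Omega>)"
      using integrable_mult_indicator[OF _ int_ind[OF B]] integrable_mult_indicator[OF _ int_mix[OF B]]
      by (simp add: set_lebesgue_integral_def right_diff_distrib)
  qed (use B int_ind int_mix mix_H in auto)
  then show ?thesis by (simp add: mix_def)
qed

lemma integrable_\<theta>_indicator_Z:
  assumes [measurable]: "B \<in> sets borel"
  shows "integrable \<Omega> (\<lambda>\<omega>. \<theta> \<omega> * indicat_real B (Z \<omega>))"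
  by (rule Bochner_Integration.integrable_bound[OF integrable_\<theta>_p(1)])
    (auto simp: indicator_def)

text \<open>Given \<open>H\<close> the factor \<theta> can be pulled out, and it leaves only the
  alternative component of the mixture. Conditioning further on \<open>G\<close>, the kernel term is
  measurable and comes out.\<close>

lemma cond_exp_\<theta>_indicator:
  assumes B: "B \<in> sets borel"
  shows "AE \<omega> in \<Omega>. real_cond_exp \<Omega> G (\<lambda>\<omega>. \<theta> \<omega> * indicator B (Z \<omega>)) \<omega>
    = real_cond_exp \<Omega> G \<theta> \<omega> * measure (K (\<gamma> \<omega>)) B"
proof -
  let ?k = "\<lambda>\<omega>. measure (K (\<gamma> \<omega>)) B"
  have k_G: "?k \<in> borel_measurable G"
    using measurable_G(2) measurable_measure_K[OF B] by (rule measurable_compose)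
  have k_\<Omega> [measurable]: "?k \<in> borel_measurable \<Omega>"
    using subalgebra_G k_G by (rule measurable_from_subalg)
  have "AE \<omega> in \<Omega>. real_cond_exp \<Omega> H (\<lambda>\<omega>. \<theta> \<omega> * indicator B (Z \<omega>)) \<omega>
      = \<theta> \<omega> * real_cond_exp \<Omega> H (\<lambda>\<omega>. indicator B (Z \<omega>)) \<omega>"
    using B by (intro H.real_cond_exp_mult measurable_H integrable_\<theta>_indicator_Z) auto
  \<comment> \<open>Here \<theta> in \<open>{0, 1}\<close> gives
    \<open>\<theta> * (1 - \<theta>) = 0\<close> and
    \<open>\<theta> * \<theta> = \<theta>\<close>.\<close>
  then have H: "AE \<omega> in \<Omega>. real_cond_exp \<Omega> H (\<lambda>\<omega>. \<theta> \<omega> * indicator B (Z \<omega>)) \<omega> = ?k \<omega> * \<theta> \<omega>"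
    using law_given_\<theta>_p_\<gamma>_set[OF B] range by eventually_elim auto
  have "AE \<omega> in \<Omega>. real_cond_exp \<Omega> G (\<lambda>\<omega>. \<theta> \<omega> * indicator B (Z \<omega>)) \<omega>
      = real_cond_exp \<Omega> G (real_cond_exp \<Omega> H (\<lambda>\<omega>. \<theta> \<omega> * indicator B (Z \<omega>))) \<omega>"
    using G.real_cond_exp_nested_subalg[OF subalgebra_H subalgebra_H_G integrable_\<theta>_indicator_Z[OF B]]
    by (auto elim!: eventually_mono)
  moreover have "AE \<omega> in \<Omega>. real_cond_exp \<Omega> G (real_cond_exp \<Omega> H (\<lambda>\<omega>. \<theta> \<omega> * indicator B (Z \<omega>))) \<omega>
      = real_cond_exp \<Omega> G (\<lambda>\<omega>. ?k \<omega> * \<theta> \<omega>) \<omega>"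
    using H by (rule G.real_cond_exp_cong) measurable
  moreover have "AE \<omega> in \<Omega>. real_cond_exp \<Omega> G (\<lambda>\<omega>. ?k \<omega> * \<theta> \<omega>) \<omega> = ?k \<omega> * real_cond_exp \<Omega> G \<theta> \<omega>"
    using integrable_mult_measure_K[OF integrable_\<theta>_p(1) B] k_G
    by (intro G.real_cond_exp_mult) (auto simp: mult.commute)
  ultimately show ?thesis by eventually_elim simp
qed

text \<open>Conditioning the law given \<open>H\<close> on \<open>G\<close> replaces \<theta> by its
  conditional mean, while the law given \<open>G\<close> has \<open>p\<close> in that place; the two
  expressions are subtracted.\<close>

lemma cond_exp_\<theta>_times_cdf_diff:
  "AE \<omega> in \<Omega>. (real_cond_exp \<Omega> G \<theta> \<omega> - p \<omega>) * (cdf (K (\<gamma> \<omega>)) z - cdf F0 z) = 0"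
proof -
  let ?c = "cdf F0 z" and ?k = "\<lambda>\<omega>. cdf (K (\<gamma> \<omega>)) z"
  let ?I = "indicat_real {\<omega> \<in> space \<Omega>. Z \<omega> \<le> z}"
  have B: "{..z} \<in> sets borel" by simp
  have "{\<omega> \<in> space \<Omega>. Z \<omega> \<le> z} \<in> sets \<Omega>" by measurable
  then have int_I: "integrable \<Omega> ?I" by (simp add: emeasure_finite less_top[symmetric])
  have k_G: "?k \<in> borel_measurable G"
    using measurable_G(2) measurable_measure_K[OF B] unfolding cdf_def by (rule measurable_compose)
  have k_\<Omega> [measurable]: "?k \<in> borel_measurable \<Omega>"
    using subalgebra_G k_G by (rule measurable_from_subalg)
  have int_k\<theta>: "integrable \<Omega> (\<lambda>\<omega>. (?k \<omega> - ?c) * \<theta> \<omega>)"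
  proof -
    have "integrable \<Omega> (\<lambda>\<omega>. \<theta> \<omega> * measure (K (\<gamma> \<omega>)) {..z} - \<theta> \<omega> * ?c)"
      using integrable_\<theta>_p(1) B
      by (intro Bochner_Integration.integrable_diff integrable_mult_measure_K) auto
    then show ?thesis by (simp add: cdf_def algebra_simps)
  qed
  have "AE \<omega> in \<Omega>. real_cond_exp \<Omega> G ?I \<omega> = real_cond_exp \<Omega> G (real_cond_exp \<Omega> H ?I) \<omega>"
    using G.real_cond_exp_nested_subalg[OF subalgebra_H subalgebra_H_G int_I]
    by (auto elim!: eventually_mono)
  moreover have "AE \<omega> in \<Omega>. real_cond_exp \<Omega> G (real_cond_exp \<Omega> H ?I) \<omega>
      = real_cond_exp \<Omega> G (\<lambda>\<omega>. ?c + (?k \<omega> - ?c) * \<theta> \<omega>) \<omega>"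
  proof (rule G.real_cond_exp_cong)
    show "AE \<omega> in \<Omega>. real_cond_exp \<Omega> H ?I \<omega> = ?c + (?k \<omega> - ?c) * \<theta> \<omega>"
      using law_given_\<theta>_p_\<gamma>[of z] by eventually_elim (simp add: algebra_simps)
  qed measurable
  moreover have "AE \<omega> in \<Omega>. real_cond_exp \<Omega> G (\<lambda>\<omega>. ?c + (?k \<omega> - ?c) * \<theta> \<omega>) \<omega>
      = real_cond_exp \<Omega> G (\<lambda>\<omega>. ?c) \<omega> + real_cond_exp \<Omega> G (\<lambda>\<omega>. (?k \<omega> - ?c) * \<theta> \<omega>) \<omega>"
    using int_k\<theta> by (intro G.real_cond_exp_add) auto
  moreover have "AE \<omega> in \<Omega>. real_cond_exp \<Omega> G (\<lambda>\<omega>. ?c) \<omega> = ?c"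
    by (rule G.real_cond_exp_F_meas) auto
  moreover have "AE \<omega> in \<Omega>. real_cond_exp \<Omega> G (\<lambda>\<omega>. (?k \<omega> - ?c) * \<theta> \<omega>) \<omega>
      = (?k \<omega> - ?c) * real_cond_exp \<Omega> G \<theta> \<omega>"
    using int_k\<theta> k_G by (intro G.real_cond_exp_mult) auto
  ultimately show ?thesis
    using law_given_p_\<gamma>[of z] by eventually_elim (simp add: algebra_simps)
qed

lemma cond_exp_\<theta>: "AE \<omega> in \<Omega>. real_cond_exp \<Omega> G \<theta> \<omega> = p \<omega>"
proof -
  \<comment> \<open>The null set depends on \<open>z\<close>; over the rationals the union of these
    sets is still null.\<close>
  have "AE \<omega> in \<Omega>. \<forall>z\<in>\<rat>. (real_cond_exp \<Omega> G \<theta> \<omega> - p \<omega>) * (cdf (K (\<gamma> \<omega>)) z - cdf F0 z) = 0"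
    using cond_exp_\<theta>_times_cdf_diff by (intro AE_ball_countable' countable_rat)
  then show ?thesis
    using alternative_distinct
  proof eventually_elim
    case (elim \<omega>)
    interpret K: real_distribution "K (\<gamma> \<omega>)"
      using prob_space_K by (simp add: real_distribution_def real_distribution_axioms_def)
    interpret F0: real_distribution F0
      using prob_space_F0 by (simp add: real_distribution_def real_distribution_axioms_def)
    have "\<exists>z\<in>\<rat>. cdf (K (\<gamma> \<omega>)) z \<noteq> cdf F0 z"
    proof (rule ccontr)
      assume "\<not> ?thesis"
      then have eq: "cdf (K (\<gamma> \<omega>)) z = cdf F0 z" if "z \<in> \<rat>" for z using that by blast
      have "cdf (K (\<gamma> \<omega>)) x = cdf F0 x" for x
      proof -
        \<comment> \<open>Rationals approaching \<open>x\<close> strictly from above suffice, since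
          distribution functions are right continuous.\<close>
        have "\<exists>r. r \<in> \<rat> \<and> x < r \<and> r < x + 1 / Suc n" for n
          using Rats_dense_in_real[of x "x + 1 / Suc n"] by auto
        then obtain r where r: "\<And>n. r n \<in> \<rat>" "\<And>n. x < r n" "\<And>n. r n < x + 1 / Suc n"
          by metis
        have "r \<longlonglongrightarrow> x"
        proof (rule tendsto_sandwich[of "\<lambda>_. x" r sequentially "\<lambda>n. x + 1 / Suc n"])
          show "(\<lambda>n. x + 1 / Suc n) \<longlonglongrightarrow> x"
            using tendsto_add[OF tendsto_const[of x] LIMSEQ_inverse_real_of_nat]
            by (simp add: inverse_eq_divide)
        qed (use r in \<open>auto intro!: always_eventually less_imp_le\<close>)
        with r(2) have lim: "filterlim r (at_right x) sequentially"
          by (auto simp: filterlim_at less_imp_neq[symmetric] intro!: always_eventually)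
        have "(\<lambda>n. cdf (K (\<gamma> \<omega>)) (r n)) \<longlonglongrightarrow> cdf (K (\<gamma> \<omega>)) x" "(\<lambda>n. cdf F0 (r n)) \<longlonglongrightarrow> cdf F0 x"
          using K.cdf_is_right_cont[of x] F0.cdf_is_right_cont[of x]
          by (auto simp: continuous_within intro: filterlim_compose[OF _ lim])
        then show ?thesis using eq[OF r(1)] LIMSEQ_unique by auto
      qed
      then have "K (\<gamma> \<omega>) = F0"
        by (intro cdf_unique K.real_distribution_axioms F0.real_distribution_axioms) auto
      with elim show False by simp
    qed
    with elim show ?case by auto
  qed
qed

text \<open>The identity for the conditional expectation given \<open>G\<close> is put in integrated
  form, tested against events of \<open>(p, \<gamma>)\<close>. Unlike the almost-everywhere form,
  this one combines directly with independence over the coordinates.\<close>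

lemma set_integral_decision_eq_power:
  assumes B: "B \<in> sets borel" and A: "A \<in> sets borel"
  shows "(\<integral>\<omega>. indicator A (p \<omega>, \<gamma> \<omega>) *
      (\<theta> \<omega> * indicator B (Z \<omega>) - p \<omega> * measure (K (\<gamma> \<omega>)) B) \<partial>\<Omega>) = 0"
proof -
  let ?A = "(\<lambda>\<omega>. (p \<omega>, \<gamma> \<omega>)) -` A \<inter> space \<Omega>"
  have A_G: "?A \<in> sets G"
    using A pair_measurable by (auto simp: sets_sigma_gen_iff)
  then have A_\<Omega>: "?A \<in> sets \<Omega>" using subalgebra_G by (auto simp: subalgebra_def)
  note int = integrable_\<theta>_indicator_Z[OF B] integrable_mult_measure_K[OF integrable_\<theta>_p(2) B]
  have "(\<integral>\<omega>\<in>?A. \<theta> \<omega> * indicator B (Z \<omega>) \<partial>\<Omega>)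
      = (\<integral>\<omega>\<in>?A. real_cond_exp \<Omega> G (\<lambda>\<omega>. \<theta> \<omega> * indicator B (Z \<omega>)) \<omega> \<partial>\<Omega>)"
    using int(1) A_G by (rule G.real_cond_exp_intA)
  also have "\<dots> = (\<integral>\<omega>\<in>?A. p \<omega> * measure (K (\<gamma> \<omega>)) B \<partial>\<Omega>)"
  proof (rule set_lebesgue_integral_cong_AE[OF A_\<Omega>])
    show "AE \<omega>\<in>?A in \<Omega>. real_cond_exp \<Omega> G (\<lambda>\<omega>. \<theta> \<omega> * indicator B (Z \<omega>)) \<omega>
        = p \<omega> * measure (K (\<gamma> \<omega>)) B"
      using cond_exp_\<theta>_indicator[OF B] cond_exp_\<theta> by eventually_elim simp
  qed (use int in auto)
  finally have "(\<integral>\<omega>. indicator ?A \<omega> * (\<theta> \<omega> * indicator B (Z \<omega>) - p \<omega> * measure (K (\<gamma> \<omega>)) B) \<partial>\<Omega>) = 0"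
    using integrable_mult_indicator[OF A_\<Omega> int(1)] integrable_mult_indicator[OF A_\<Omega> int(2)]
    by (simp add: set_lebesgue_integral_def right_diff_distrib)
  also have "(\<integral>\<omega>. indicator ?A \<omega> * (\<theta> \<omega> * indicator B (Z \<omega>) - p \<omega> * measure (K (\<gamma> \<omega>)) B) \<partial>\<Omega>)
      = (\<integral>\<omega>. indicator A (p \<omega>, \<gamma> \<omega>) *
      (\<theta> \<omega> * indicator B (Z \<omega>) - p \<omega> * measure (K (\<gamma> \<omega>)) B) \<partial>\<Omega>)"
    by (intro Bochner_Integration.integral_cong) (auto simp: indicator_def)
  finally show ?thesis .
qed

end

section \<open>Conditioning on the whole family\<close>

text \<open>On a rectangle, independence factorises the integral, and the factor of index
  \<open>m\<close> is zero by hypothesis. The Dynkin principle passes from rectangles to all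
  product-measurable sets.\<close>

lemma (in prob_space) integral_indicator_family_eq_0:
  fixes X :: "'i \<Rightarrow> 'a \<Rightarrow> 'b::topological_space" and v :: "'b \<Rightarrow> 'c::topological_space" and w :: "'b \<Rightarrow> real"
  assumes indep: "indep_vars (\<lambda>_. borel) X I" and I: "finite I" and m: "m \<in> I"
    and v: "v \<in> borel_measurable borel" and w: "w \<in> borel_measurable borel"
    and int: "integrable M (\<lambda>\<omega>. w (X m \<omega>))"
    and zero: "\<And>A. A \<in> sets borel \<Longrightarrow> (\<integral>\<omega>. indicator A (v (X m \<omega>)) * w (X m \<omega>) \<partial>M) = 0"
    and B: "B \<in> sets (PiM I (\<lambda>_. borel))"
  shows "(\<integral>\<omega>. indicator B (\<lambda>i\<in>I. v (X i \<omega>)) * w (X m \<omega>) \<partial>M) = 0"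
proof -
  let ?\<Pi> = "\<Pi>\<^sub>E i\<in>I. space (borel :: 'c measure)" and ?G = "prod_algebra I (\<lambda>_. borel :: 'c measure)"
  let ?V = "\<lambda>\<omega>. \<lambda>i\<in>I. v (X i \<omega>)"
  have \<Pi>: "sigma_sets ?\<Pi> ?G = sets (PiM I (\<lambda>_. borel))" by (simp only: sets_PiM)
  have X [measurable]: "X i \<in> borel_measurable M" if "i \<in> I" for i
    using indep that by (auto simp: indep_vars_def2)
  have V [measurable]: "?V \<in> measurable M (PiM I (\<lambda>_. borel))"
    using measurable_compose[OF X v] by (intro measurable_restrict) auto
  have w_X [measurable]: "(\<lambda>\<omega>. w (X m \<omega>)) \<in> borel_measurable M" using int by auto
  show ?thesis
  proof (rule integral_signed_kernel_eq_0[where G = ?G and X = ?\<Pi> and w = "\<lambda>\<omega>. \<bar>w (X m \<omega>)\<bar>" and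
        h = "\<lambda>\<omega> B. indicator B (?V \<omega>) * w (X m \<omega>)"], unfold \<Pi>)
    show "Int_stable ?G" by (rule Int_stable_prod_algebra)
    show "?G \<subseteq> Pow ?\<Pi>" by (rule prod_algebra_sets_into_space)
    show "integrable M (\<lambda>\<omega>. \<bar>w (X m \<omega>)\<bar>)" using int by (rule integrable_abs)
    show "B \<in> sets (PiM I (\<lambda>_. borel))" by (rule B)
    fix A :: "('i \<Rightarrow> 'c) set" assume [measurable]: "A \<in> sets (PiM I (\<lambda>_. borel))"
    show "(\<lambda>\<omega>. indicator A (?V \<omega>) * w (X m \<omega>)) \<in> borel_measurable M" by measurable
    show "\<bar>indicator A (?V \<omega>) * w (X m \<omega>)\<bar> \<le> \<bar>w (X m \<omega>)\<bar>" for \<omega>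
      by (simp add: indicator_def)
  next
    fix A :: "nat \<Rightarrow> ('i \<Rightarrow> 'c) set" and \<omega> assume "disjoint_family A"
    then show "(\<lambda>i. indicator (A i) (?V \<omega>) * w (X m \<omega>)) sums (indicator (\<Union>i. A i) (?V \<omega>) * w (X m \<omega>))"
      by (intro sums_mult2 indicator_sums) (auto simp: disjoint_family_on_def)
  next
    \<comment> \<open>The tuple \<open>?V \<omega>\<close> always lies in the full rectangle, so
      this is the case \<open>A = UNIV\<close> of \<open>zero\<close>.\<close>
    show "(\<integral>\<omega>. indicator ?\<Pi> (?V \<omega>) * w (X m \<omega>) \<partial>M) = 0"
      using zero[of UNIV] by (simp add: PiE_def Pi_def)
  next
    fix A assume "A \<in> ?G"
    then obtain E where E: "A = Pi\<^sub>E I E" "\<And>i. i \<in> I \<Longrightarrow> E i \<in> sets borel"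
      by (auto simp: prod_algebra_eq_finite[OF I])
    \<comment> \<open>The weight \<open>w\<close> is attached to the factor of index
      \<open>m\<close> alone; all other factors are pure indicators.\<close>
    define Y where "Y i x = indicator (E i) (v x) * (if i = m then w x else 1)" for i x
    have Y: "Y i \<in> borel_measurable borel" if "i \<in> I" for i
    proof -
      note [measurable] = E(2)[OF that] v w
      show ?thesis unfolding Y_def by measurable
    qed
    have "indicator A (?V \<omega>) * w (X m \<omega>) = (\<Prod>i\<in>I. Y i (X i \<omega>))" for \<omega>
    proof -
      have "(\<Prod>i\<in>I. Y i (X i \<omega>))
          = (\<Prod>i\<in>I. indicator (E i) (v (X i \<omega>))) * (\<Prod>i\<in>I. if i = m then w (X i \<omega>) else 1)"
        by (simp add: Y_def prod.distrib)
      also have "(\<Prod>i\<in>I. if i = m then w (X i \<omega>) else 1) = w (X m \<omega>)"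
        using m I by (subst prod.delta) auto
      also have "(\<Prod>i\<in>I. indicator (E i) (v (X i \<omega>)) :: real) = indicator A (?V \<omega>)"
      proof (cases "\<forall>i\<in>I. v (X i \<omega>) \<in> E i")
        case True
        then show ?thesis by (simp add: E(1))
      next
        case False
        then obtain i where "i \<in> I" "v (X i \<omega>) \<notin> E i" by blast
        then have "(\<Prod>i\<in>I. indicator (E i) (v (X i \<omega>)) :: real) = 0" "?V \<omega> \<notin> A"
          using I by (auto simp: E(1) prod_zero_iff PiE_iff intro!: bexI[of _ i])
        then show ?thesis by simp
      qed
      finally show ?thesis by simp
    qed
    then have "(\<integral>\<omega>. indicator A (?V \<omega>) * w (X m \<omega>) \<partial>M) = (\<integral>\<omega>. (\<Prod>i\<in>I. Y i (X i \<omega>)) \<partial>M)"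
      by simp
    also have "\<dots> = (\<Prod>i\<in>I. \<integral>\<omega>. Y i (X i \<omega>) \<partial>M)"
    proof (rule indep_vars_lebesgue_integral[OF I indep_vars_compose2[OF indep Y]])
      fix i assume i: "i \<in> I"
      have "integrable M (\<lambda>\<omega>. if i = m then w (X m \<omega>) else 1)"
        using int by (cases "i = m") auto
      then show "integrable M (\<lambda>\<omega>. Y i (X i \<omega>))"
      proof (rule Bochner_Integration.integrable_bound)
        show "(\<lambda>\<omega>. Y i (X i \<omega>)) \<in> borel_measurable M"
          using measurable_compose[OF X Y] i by blast
      qed (auto simp: Y_def indicator_def)
    qed
    also have "\<dots> = 0"
      using zero[OF E(2)[OF m]] m I by (auto simp: Y_def prod_zero_iff intro!: bexI[of _ m])
    finally show "(\<integral>\<omega>. indicator A (?V \<omega>) * w (X m \<omega>) \<partial>M) = 0" .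
  qed
qed

lemma borel_measurable_quadruple_components:
  "(\<lambda>x::real \<times> real \<times> real \<times> real. fst x) \<in> borel_measurable borel"
  "(\<lambda>x::real \<times> real \<times> real \<times> real. fst (snd x)) \<in> borel_measurable borel"
  "(\<lambda>x::real \<times> real \<times> real \<times> real. fst (snd (snd x))) \<in> borel_measurable borel"
  "(\<lambda>x::real \<times> real \<times> real \<times> real. snd (snd (snd x))) \<in> borel_measurable borel"
  by (auto intro!: borel_measurable_continuous_onI continuous_intros)

text \<open>An affine function attains equality in the midpoint inequality between 0 and 1.\<close>

lemma not_A1_identity:
  assumes "\<And>t. t \<in> {0..1} \<Longrightarrow> f t = t"
  shows "\<not> A1 f"
proof
  assume "A1 f"
  then have "strictly_concave_on {0..1} f" by (simp add: A1_def)
  then have "(1 - 1/2) * f 0 + 1/2 * f 1 < f ((1 - 1/2) * 0 + 1/2 * 1)"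
    by (rule strictly_concave_onD) auto
  then show False by (simp add: assms)
qed

section \<open>Conditional expected discoveries in Model 1\<close>

context model1
begin

lemma component_measurable:
  assumes m: "m \<in> {1..M}"
  shows "Z m \<in> borel_measurable \<Omega>" "\<theta> m \<in> borel_measurable \<Omega>"
    "p m \<in> borel_measurable \<Omega>" "\<gamma> m \<in> borel_measurable \<Omega>"
proof -
  have "(\<lambda>\<omega>. (Z m \<omega>, \<theta> m \<omega>, p m \<omega>, \<gamma> m \<omega>)) \<in> borel_measurable \<Omega>"
    using independent m by (auto simp: indep_vars_def2)
  from borel_measurable_quadruple_components[THEN measurable_compose[OF this]]
  show "Z m \<in> borel_measurable \<Omega>" "\<theta> m \<in> borel_measurable \<Omega>"
    "p m \<in> borel_measurable \<Omega>" "\<gamma> m \<in> borel_measurable \<Omega>"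
    by simp_all
qed

text \<open>The kernel is only specified on nonnegative effects; truncation makes it total.\<close>

definition "K g = F1 (max 0 g)"

lemma K_measurable: "K \<in> measurable borel (prob_algebra borel)"
proof -
  have "(\<lambda>g::real. max 0 g) \<in> measurable borel (restrict_space borel {0..})"
    by (intro measurable_restrict_space2) auto
  from measurable_compose[OF this F1_kernel] show ?thesis
    by (simp add: K_def[abs_def])
qed

text \<open>If the two laws agreed, the size condition would make the power function the identity, which
  is not strictly concave.\<close>

lemma alternative_neq_null:
  assumes NS: "NS_decision \<Omega> (Z m) F0 d" and A1: "A1 (power_fun F1 d g)" and g: "0 \<le> g"
  shows "K g \<noteq> F0"
proof
  assume "K g = F0"
  with g have "power_fun F1 d g t = t" if "t \<in> {0..1}" for t
    using NS that by (simp add: NS_decision_def power_fun_def K_def)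
  with not_A1_identity A1 show False by blast
qed

text \<open>Effects are almost surely nonnegative, so the truncated kernel agrees with
  \<open>F1\<close> where the conditional laws are evaluated. Distinctness of the two laws follows
  from (A1) and the size condition.\<close>

lemma mixture_observation:
  assumes m: "m \<in> {1..M}" and NS: "NS_decision \<Omega> (Z m) F0 d"
    and A1: "AE \<omega> in \<Omega>. A1 (power_fun F1 d (\<gamma> m \<omega>))"
  shows "mixture_observation \<Omega> (Z m) (\<theta> m) (p m) (\<gamma> m) F0 K"
proof
  note support_m = support[OF m]
  show "AE \<omega> in \<Omega>. \<theta> m \<omega> \<in> {0, 1} \<and> p m \<omega> \<in> {0..1}"
    using support_m by eventually_elim simp
  show "AE \<omega> in \<Omega>. real_cond_exp \<Omega> (sigma_gen \<Omega> borel (\<lambda>\<omega>. (\<theta> m \<omega>, p m \<omega>, \<gamma> m \<omega>)))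
      (indicator {\<omega> \<in> space \<Omega>. Z m \<omega> \<le> z}) \<omega>
      = (1 - \<theta> m \<omega>) * cdf F0 z + \<theta> m \<omega> * cdf (K (\<gamma> m \<omega>)) z" for z
    using cond_distribution_theta_p_gamma[OF m, of z] support_m
    by eventually_elim (simp add: K_def)
  show "AE \<omega> in \<Omega>. real_cond_exp \<Omega> (sigma_gen \<Omega> borel (\<lambda>\<omega>. (p m \<omega>, \<gamma> m \<omega>)))
      (indicator {\<omega> \<in> space \<Omega>. Z m \<omega> \<le> z}) \<omega>
      = (1 - p m \<omega>) * cdf F0 z + p m \<omega> * cdf (K (\<gamma> m \<omega>)) z" for z
    using cond_distribution_p_gamma[OF m, of z] support_m
    by eventually_elim (simp add: K_def)
  show "AE \<omega> in \<Omega>. K (\<gamma> m \<omega>) \<noteq> F0"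
    using A1 support_m by eventually_elim (use alternative_neq_null[OF NS] in auto)
qed (use component_measurable[OF m] F0_distribution K_measurable in auto)

text \<open>By linearity each summand is treated alone: its single-coordinate identity survives
  conditioning on the whole family because the other coordinates are independent of it.\<close>

lemma cond_exp_discoveries:
  assumes NS: "\<And>m. m \<in> {1..M} \<Longrightarrow> NS_decision \<Omega> (Z m) F0 (\<delta> m)"
    and A1: "\<And>m. m \<in> {1..M} \<Longrightarrow> AE \<omega> in \<Omega>. A1 (power_fun F1 (\<delta> m) (\<gamma> m \<omega>))"
    and \<tau>: "\<tau> \<in> thresholds M"
  shows "AE \<omega> in \<Omega>. real_cond_exp \<Omega>
      (sigma_gen \<Omega> (PiM {1..M} (\<lambda>_. borel)) (\<lambda>\<omega>. \<lambda>m\<in>{1..M}. (p m \<omega>, \<gamma> m \<omega>)))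
      (\<lambda>\<omega>. \<Sum>m\<in>{1..M}. \<theta> m \<omega> * \<delta> m (Z m \<omega>) (\<tau> m)) \<omega>
    = mean_power M F1 \<delta> \<tau> (\<lambda>m. p m \<omega>) (\<lambda>m. \<gamma> m \<omega>)"
proof -
  let ?I = "{1..M}"
  let ?V = "\<lambda>\<omega>. \<lambda>m\<in>?I. (p m \<omega>, \<gamma> m \<omega>)"
  let ?P = "PiM ?I (\<lambda>_. borel :: (real \<times> real) measure)"
  let ?S = "sigma_gen \<Omega> ?P ?V"
  \<comment> \<open>\<open>B m\<close> is the rejection region at threshold \<open>\<tau> m\<close>.
    Decisions take only the values 0 and 1, so each one is the indicator of this region.\<close>
  define B where "B m = {z. \<delta> m z (\<tau> m) = 1}" for m
  define num where "num m \<omega> = \<theta> m \<omega> * indicator (B m) (Z m \<omega>)" for m \<omega>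
  define pow where "pow m \<omega> = p m \<omega> * measure (K (\<gamma> m \<omega>)) (B m)" for m \<omega>
  have obs: "mixture_observation \<Omega> (Z m) (\<theta> m) (p m) (\<gamma> m) F0 K" if "m \<in> ?I" for m
    using mixture_observation[OF that NS A1] that by blast
  have \<tau>_range: "\<tau> m \<in> {0..1}" if "m \<in> ?I" for m
    using \<tau> that by (auto simp: thresholds_def)
  have \<delta>: "(\<lambda>z. \<delta> m z (\<tau> m)) \<in> borel_measurable borel" "\<delta> m z (\<tau> m) = indicator (B m) z"
    if "m \<in> ?I" for m z
  proof -
    have "(\<lambda>z. \<delta> m z (\<tau> m)) \<in> borel_measurable borel" "\<delta> m z (\<tau> m) \<in> {0, 1}"
      using NS[OF that] \<tau>_range[OF that] by (auto simp: NS_decision_def)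
    then show "(\<lambda>z. \<delta> m z (\<tau> m)) \<in> borel_measurable borel" "\<delta> m z (\<tau> m) = indicator (B m) z"
      by (auto simp: B_def indicator_def)
  qed
  have B: "B m \<in> sets borel" if "m \<in> ?I" for m
    using borel_measurable_const[of 1 borel] \<delta>(1)[OF that] unfolding B_def
    by measurable
  have V: "?V \<in> measurable \<Omega> ?P"
    using component_measurable by (intro measurable_restrict borel_measurable_Pair) auto
  interpret S: finite_measure_subalgebra \<Omega> ?S
    by standard (rule subalgebra_sigma_gen[OF V])
  have int: "integrable \<Omega> (num m)" "integrable \<Omega> (pow m)" if m: "m \<in> ?I" for m
  proof -
    interpret mixture_observation \<Omega> "Z m" "\<theta> m" "p m" "\<gamma> m" F0 K by (rule obs[OF m])
    show "integrable \<Omega> (num m)" "integrable \<Omega> (pow m)"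
      unfolding num_def[abs_def] pow_def[abs_def]
      using integrable_\<theta>_indicator_Z[OF B[OF m]] integrable_mult_measure_K[OF integrable_\<theta>_p(2) B[OF m]]
      by simp_all
  qed
  have pow_S: "pow m \<in> borel_measurable ?S" if m: "m \<in> ?I" for m
  proof -
    interpret mixture_observation \<Omega> "Z m" "\<theta> m" "p m" "\<gamma> m" F0 K by (rule obs[OF m])
    note components = borel_measurable_pair_components[THEN
        measurable_compose[OF measurable_component_singleton[OF m]]]
    have "(\<lambda>v. fst (v m) * measure (K (snd (v m))) (B m)) \<in> borel_measurable ?P"
      using components(1) measurable_compose[OF components(2) measurable_measure_K[OF B[OF m]]]
      by (rule borel_measurable_times)
    from measurable_sigma_gen_compose[OF V this] m show ?thesis by (simp add: pow_def[abs_def])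
  qed
  have zero: "(\<integral>\<omega>. indicator C (?V \<omega>) * (num m \<omega> - pow m \<omega>) \<partial>\<Omega>) = 0"
    if m: "m \<in> ?I" and C: "C \<in> sets ?P" for m C
  proof -
    interpret mixture_observation \<Omega> "Z m" "\<theta> m" "p m" "\<gamma> m" F0 K by (rule obs[OF m])
    \<comment> \<open>\<open>v\<close> extracts the conditioning pair from the full random vector,
      and \<open>w\<close> is the discovery minus its predicted power, whose integral over every
      event of that pair is zero.\<close>
    define v where "v x = (fst (snd (snd x)), snd (snd (snd x)))" for x :: "real \<times> real \<times> real \<times> real"
    define w where "w x = fst (snd x) * indicator (B m) (fst x)
        - fst (snd (snd x)) * measure (K (snd (snd (snd x)))) (B m)" for x :: "real \<times> real \<times> real \<times> real"
    note components = borel_measurable_quadruple_components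
    have B_ind: "indicat_real (B m) \<in> borel_measurable borel"
      using B[OF m] by (rule borel_measurable_indicator)
    have "(\<integral>\<omega>. indicator C (\<lambda>i\<in>?I. v (Z i \<omega>, \<theta> i \<omega>, p i \<omega>, \<gamma> i \<omega>)) *
        w (Z m \<omega>, \<theta> m \<omega>, p m \<omega>, \<gamma> m \<omega>) \<partial>\<Omega>) = 0"
    proof (rule integral_indicator_family_eq_0[OF independent _ m _ _ _ _ C])
      show "v \<in> borel_measurable borel" unfolding v_def
        using components(3,4) by (rule borel_measurable_Pair)
      show "w \<in> borel_measurable borel" unfolding w_def
        by (intro borel_measurable_diff borel_measurable_times components
            measurable_compose[OF components(1) B_ind]
            measurable_compose[OF components(4) measurable_measure_K[OF B[OF m]]])
      show "integrable \<Omega> (\<lambda>\<omega>. w (Z m \<omega>, \<theta> m \<omega>, p m \<omega>, \<gamma> m \<omega>))"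
        using Bochner_Integration.integrable_diff[OF int[OF m]]
        by (simp add: w_def num_def[abs_def] pow_def[abs_def])
      fix A :: "(real \<times> real) set" assume "A \<in> sets borel"
      with set_integral_decision_eq_power[OF B[OF m]]
      show "(\<integral>\<omega>. indicator A (v (Z m \<omega>, \<theta> m \<omega>, p m \<omega>, \<gamma> m \<omega>)) *
          w (Z m \<omega>, \<theta> m \<omega>, p m \<omega>, \<gamma> m \<omega>) \<partial>\<Omega>) = 0"
        by (simp add: v_def w_def)
    qed simp
    then show ?thesis by (simp add: v_def w_def num_def pow_def cong: restrict_cong)
  qed
  have "AE \<omega> in \<Omega>. real_cond_exp \<Omega> ?S (\<lambda>\<omega>. \<Sum>m\<in>?I. num m \<omega>) \<omega> = (\<Sum>m\<in>?I. pow m \<omega>)"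
  proof (rule S.real_cond_exp_charact)
    fix A assume A: "A \<in> sets ?S"
    then obtain C where C: "C \<in> sets ?P" "A = ?V -` C \<inter> space \<Omega>"
      unfolding sets_sigma_gen_iff[OF V] by blast
    have A_\<Omega>: "A \<in> sets \<Omega>" using A S.subalg by (auto simp: subalgebra_def)
    have eq: "(\<integral>\<omega>\<in>A. num m \<omega> \<partial>\<Omega>) = (\<integral>\<omega>\<in>A. pow m \<omega> \<partial>\<Omega>)" if m: "m \<in> ?I" for m
    proof -
      have "(\<integral>\<omega>. indicator A \<omega> * (num m \<omega> - pow m \<omega>) \<partial>\<Omega>)
          = (\<integral>\<omega>. indicator C (?V \<omega>) * (num m \<omega> - pow m \<omega>) \<partial>\<Omega>)"
        by (intro Bochner_Integration.integral_cong) (auto simp: C(2) indicator_def)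
      then show ?thesis
        using zero[OF m C(1)] integrable_mult_indicator[OF A_\<Omega> int(1)[OF m]]
          integrable_mult_indicator[OF A_\<Omega> int(2)[OF m]]
        by (simp add: set_lebesgue_integral_def right_diff_distrib)
    qed
    have sum: "(\<integral>\<omega>\<in>A. (\<Sum>m\<in>?I. g m \<omega>) \<partial>\<Omega>) = (\<Sum>m\<in>?I. \<integral>\<omega>\<in>A. g m \<omega> \<partial>\<Omega>)"
      if "\<And>m. m \<in> ?I \<Longrightarrow> integrable \<Omega> (g m)" for g :: "nat \<Rightarrow> 'w \<Rightarrow> real"
      unfolding set_lebesgue_integral_def scaleR_sum_right
      by (intro Bochner_Integration.integral_sum integrable_mult_indicator A_\<Omega> that)
    show "(\<integral>\<omega>\<in>A. (\<Sum>m\<in>?I. num m \<omega>) \<partial>\<Omega>) = (\<integral>\<omega>\<in>A. (\<Sum>m\<in>?I. pow m \<omega>) \<partial>\<Omega>)"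
      using sum[of num] sum[of pow] int eq by simp
  qed (use int pow_S in auto)
  moreover have "(\<lambda>\<omega>. \<Sum>m\<in>?I. num m \<omega>) = (\<lambda>\<omega>. \<Sum>m\<in>?I. \<theta> m \<omega> * \<delta> m (Z m \<omega>) (\<tau> m))"
    by (intro ext sum.cong) (simp_all add: num_def \<delta>(2))
  moreover have "AE \<omega> in \<Omega>. (\<Sum>m\<in>?I. pow m \<omega>) = mean_power M F1 \<delta> \<tau> (\<lambda>m. p m \<omega>) (\<lambda>m. \<gamma> m \<omega>)"
  proof -
    \<comment> \<open>On this event the truncation has no effect, and the measure of the rejection
      region under \<open>F1\<close> is the power function.\<close>
    have "AE \<omega> in \<Omega>. \<forall>m\<in>?I. 0 \<le> \<gamma> m \<omega>"
      using support by (intro AE_finite_allI) (auto elim!: eventually_mono)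
    then show ?thesis
    proof eventually_elim
      case (elim \<omega>)
      have "measure (K (\<gamma> m \<omega>)) (B m) = power_fun F1 (\<delta> m) (\<gamma> m \<omega>) (\<tau> m)" if m: "m \<in> ?I" for m
      proof -
        interpret mixture_observation \<Omega> "Z m" "\<theta> m" "p m" "\<gamma> m" F0 K by (rule obs[OF m])
        have "K (\<gamma> m \<omega>) = F1 (\<gamma> m \<omega>)" using elim m by (simp add: K_def)
        moreover have "B m \<in> sets (K (\<gamma> m \<omega>))" using B[OF m] prob_space_K by simp
        ultimately show ?thesis
          using sets_eq_imp_space_eq[OF prob_space_K(2)[of "\<gamma> m \<omega>"]]
          by (simp add: power_fun_def \<delta>(2)[OF m])
      qed
      then show ?case by (simp add: mean_power_def pow_def)
    qed
  qed
  ultimately show ?thesis by auto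
qed

end

text \<open>Conditional expectations are fixed only up to a null set depending on
  \<open>\<tau>\<close>, so that quantifier stands outside the almost-everywhere statement, and
  maximisation uses the version \<open>mean_power\<close>, given for every realisation. Positivity
  of \<open>p m \<omega>\<close> gives \<open>k / p m \<omega>\<close> its meaning: at
  \<open>p m \<omega> = 0\<close> its formal value is 0, which the marginal power does not attain
  inside the unit interval.\<close>

theorem theorem1:
  fixes \<Omega> :: "'w measure" and M :: nat
    and Z \<theta> p \<gamma> :: "nat \<Rightarrow> 'w \<Rightarrow> real"
    and F0 :: "real measure" and F1 :: "real \<Rightarrow> real measure"
    and a0 t :: real
    and \<delta> :: "nat \<Rightarrow> real \<Rightarrow> real \<Rightarrow> real"
  assumes "model1 \<Omega> M Z \<theta> p \<gamma> F0 F1 a0"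
    and "\<forall>m\<in>{1..M}. NS_decision \<Omega> (Z m) F0 (\<delta> m)"
    and "\<forall>m\<in>{1..M}. AE \<omega> in \<Omega>. A1 (power_fun F1 (\<delta> m) (\<gamma> m \<omega>))"
    and "t \<in> {0<..<1}"
  shows "(\<forall>\<tau>\<in>thresholds M. AE \<omega> in \<Omega>.
            real_cond_exp \<Omega>
              (sigma_gen \<Omega> (PiM {1..M} (\<lambda>_. borel)) (\<lambda>\<omega>. \<lambda>m\<in>{1..M}. (p m \<omega>, \<gamma> m \<omega>)))
              (\<lambda>\<omega>. \<Sum>m\<in>{1..M}. \<theta> m \<omega> * \<delta> m (Z m \<omega>) (\<tau> m)) \<omega>
            = mean_power M F1 \<delta> \<tau> (\<lambda>m. p m \<omega>) (\<lambda>m. \<gamma> m \<omega>))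
       \<and> (AE \<omega> in \<Omega>. (\<forall>m\<in>{1..M}. 0 < p m \<omega>) \<longrightarrow>
            (\<exists>\<tau>. (\<forall>\<sigma>. is_arg_max (\<lambda>\<sigma>. mean_power M F1 \<delta> \<sigma> (\<lambda>m. p m \<omega>) (\<lambda>m. \<gamma> m \<omega>))
                          (\<lambda>\<sigma>. \<sigma> \<in> feasible M t) \<sigma> \<longleftrightarrow> \<sigma> = \<tau>)
               \<and> (\<exists>k>0. \<forall>m\<in>{1..M}. \<tau> m \<in> {0<..<1} \<and>
                    deriv (power_fun F1 (\<delta> m) (\<gamma> m \<omega>)) (\<tau> m) = k / p m \<omega>)))"
proof (intro conjI ballI)
  interpret model1 \<Omega> M Z \<theta> p \<gamma> F0 F1 a0 by (rule assms(1))
  fix \<tau> assume "\<tau> \<in> thresholds M"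
  with assms(2,3)
  show "AE \<omega> in \<Omega>. real_cond_exp \<Omega>
      (sigma_gen \<Omega> (PiM {1..M} (\<lambda>_. borel)) (\<lambda>\<omega>. \<lambda>m\<in>{1..M}. (p m \<omega>, \<gamma> m \<omega>)))
      (\<lambda>\<omega>. \<Sum>m\<in>{1..M}. \<theta> m \<omega> * \<delta> m (Z m \<omega>) (\<tau> m)) \<omega>
    = mean_power M F1 \<delta> \<tau> (\<lambda>m. p m \<omega>) (\<lambda>m. \<gamma> m \<omega>)"
    by (intro cond_exp_discoveries) auto
next
  interpret model1 \<Omega> M Z \<theta> p \<gamma> F0 F1 a0 by (rule assms(1))
  \<comment> \<open>One null set serves all finitely many \<open>m\<close>; outside it \<omega> is
    fixed and the optimisation is deterministic.\<close>
  have "AE \<omega> in \<Omega>. \<forall>m\<in>{1..M}. A1 (power_fun F1 (\<delta> m) (\<gamma> m \<omega>))"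
    using assms(3) by (intro AE_finite_allI) auto
  then show "AE \<omega> in \<Omega>. (\<forall>m\<in>{1..M}. 0 < p m \<omega>) \<longrightarrow>
      (\<exists>\<tau>. (\<forall>\<sigma>. is_arg_max (\<lambda>\<sigma>. mean_power M F1 \<delta> \<sigma> (\<lambda>m. p m \<omega>) (\<lambda>m. \<gamma> m \<omega>))
                    (\<lambda>\<sigma>. \<sigma> \<in> feasible M t) \<sigma> \<longleftrightarrow> \<sigma> = \<tau>)
         \<and> (\<exists>k>0. \<forall>m\<in>{1..M}. \<tau> m \<in> {0<..<1} \<and>
              deriv (power_fun F1 (\<delta> m) (\<gamma> m \<omega>)) (\<tau> m) = k / p m \<omega>))"
  proof eventually_elim
    case (elim \<omega>)
    show ?case
      unfolding mean_power_def
      by (intro impI unique_optimal_thresholds M_pos assms(4)) (use elim in auto)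
  qed
qed

end
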